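(* Let $\Omega\subset\mathbb{R}^n$ be open and $V$ a distribution of $k$-planes of class $C^1$ on $\Omega$. Let $A\subset\mathbb{R}^k$ be open and $u:A\to\Omega$ a continuous map of class $W^{1,p}_{\mathrm{loc}}$ with $p>k$ such that for a.e. $z\in A$ the image of the differential of $u$ at $z$ equals $V(u(z))$. Then $u(A)$ does not intersect the non-involutivity set $N(V)$.
   Context: A distribution of $k$-planes of class $C^1$ is a $C^1$ map $x\mapsto V(x)$ into the Grassmannian of $k$-planes of $\mathbb{R}^n$. $V$ is involutive at $x$ if $[w,w'](x)\in V(x)$ for all $C^1$ vectorfields $w,w'$ on $\Omega$ tangent to $V$, where $[w,w']=\mathrm{d}w(w')-\mathrm{d}w'(w)$; $N(V)$ is the set of points where $V$ is not involutive. *)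

theory Defs
  imports "HOL-Analysis.Analysis"
begin

definition C1_with :: "'a::real_normed_vector set \<Rightarrow> ('a \<Rightarrow> 'b::real_normed_vector) \<Rightarrow> ('a \<Rightarrow> ('a \<Rightarrow>\<^sub>L 'b)) \<Rightarrow> bool" where
  "C1_with S f f' \<longleftrightarrow> (\<forall>x\<in>S. (f has_derivative blinfun_apply (f' x)) (at x)) \<and> continuous_on S f'"

definition C1_on :: "'a::real_normed_vector set \<Rightarrow> ('a \<Rightarrow> 'b::real_normed_vector) \<Rightarrow> bool" where
  "C1_on S f \<longleftrightarrow> (\<exists>f'. C1_with S f f')"

definition is_orth_proj :: "real^'n^'n \<Rightarrow> (real^'n) set \<Rightarrow> bool" where
  "is_orth_proj P W \<longleftrightarrow> (\<forall>y. P *v y \<in> W \<and> (\<forall>w\<in>W. (y - P *v y) \<bullet> w = 0))"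

(* C^1 distribution of k-planes on \<Omega>: a map into the Grassmannian G(k,n), the Grassmannian
   carrying its standard smooth structure (realised through the embedding by orthogonal projections) *)
definition C1_distribution :: "(real^'n) set \<Rightarrow> nat \<Rightarrow> (real^'n \<Rightarrow> (real^'n) set) \<Rightarrow> bool" where
  "C1_distribution \<Omega> k V \<longleftrightarrow>
     (\<forall>x\<in>\<Omega>. subspace (V x) \<and> dim (V x) = k) \<and>
     (\<exists>P :: real^'n \<Rightarrow> real^'n^'n. C1_on \<Omega> P \<and> (\<forall>x\<in>\<Omega>. is_orth_proj (P x) (V x)))"

definition tangent_C1_field :: "(real^'n) set \<Rightarrow> (real^'n \<Rightarrow> (real^'n) set) \<Rightarrow> (real^'n \<Rightarrow> real^'n) \<Rightarrow> (real^'n \<Rightarrow> ((real^'n) \<Rightarrow>\<^sub>L (real^'n))) \<Rightarrow> bool" where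
  "tangent_C1_field \<Omega> V w Dw \<longleftrightarrow> C1_with \<Omega> w Dw \<and> (\<forall>x\<in>\<Omega>. w x \<in> V x)"

definition involutive_at :: "(real^'n) set \<Rightarrow> (real^'n \<Rightarrow> (real^'n) set) \<Rightarrow> real^'n \<Rightarrow> bool" where
  "involutive_at \<Omega> V x \<longleftrightarrow>
     (\<forall>w Dw w' Dw'. tangent_C1_field \<Omega> V w Dw \<and> tangent_C1_field \<Omega> V w' Dw' \<longrightarrow>
        blinfun_apply (Dw x) (w' x) - blinfun_apply (Dw' x) (w x) \<in> V x)"

definition non_involutive_set :: "(real^'n) set \<Rightarrow> (real^'n \<Rightarrow> (real^'n) set) \<Rightarrow> (real^'n) set" where
  "non_involutive_set \<Omega> V = {x\<in>\<Omega>. \<not> involutive_at \<Omega> V x}"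

primrec Cm_fun :: "nat \<Rightarrow> (real^'k \<Rightarrow> real) \<Rightarrow> bool" where
  "Cm_fun 0 f \<longleftrightarrow> continuous_on UNIV f"
| "Cm_fun (Suc m) f \<longleftrightarrow> (\<exists>D :: 'k \<Rightarrow> real^'k \<Rightarrow> real.
      (\<forall>z. (f has_derivative (\<lambda>h. \<Sum>i\<in>UNIV. h $ i * D i z)) (at z)) \<and> (\<forall>i. Cm_fun m (D i)))"

definition test_function :: "(real^'k) set \<Rightarrow> (real^'k \<Rightarrow> real) \<Rightarrow> bool" where
  "test_function A \<phi> \<longleftrightarrow> (\<forall>m. Cm_fun m \<phi>) \<and>
      compact (closure {z. \<phi> z \<noteq> 0}) \<and> closure {z. \<phi> z \<noteq> 0} \<subseteq> A"

definition Lp_loc :: "real \<Rightarrow> (real^'k) set \<Rightarrow> (real^'k \<Rightarrow> 'b::euclidean_space) \<Rightarrow> bool" where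
  "Lp_loc p A f \<longleftrightarrow> set_borel_measurable lebesgue A f \<and>
     (\<forall>K. compact K \<and> K \<subseteq> A \<longrightarrow> set_integrable lebesgue K (\<lambda>z. norm (f z) powr p))"

definition weak_partial :: "(real^'k) set \<Rightarrow> 'k \<Rightarrow> (real^'k \<Rightarrow> 'b::euclidean_space) \<Rightarrow> (real^'k \<Rightarrow> 'b) \<Rightarrow> bool" where
  "weak_partial A i u g \<longleftrightarrow> (\<forall>\<phi>. test_function A \<phi> \<longrightarrow>
     set_lebesgue_integral lebesgue A (\<lambda>z. frechet_derivative \<phi> (at z) (axis i 1) *\<^sub>R u z)
       = - set_lebesgue_integral lebesgue A (\<lambda>z. \<phi> z *\<^sub>R g z))"

definition W1p_loc_with :: "real \<Rightarrow> (real^'k) set \<Rightarrow> (real^'k \<Rightarrow> 'b::euclidean_space) \<Rightarrow> ('k \<Rightarrow> real^'k \<Rightarrow> 'b) \<Rightarrow> bool" where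
  "W1p_loc_with p A u Du \<longleftrightarrow> Lp_loc p A u \<and> (\<forall>i. Lp_loc p A (Du i) \<and> weak_partial A i u (Du i))"

definition diff_image :: "('k::finite \<Rightarrow> real^'k \<Rightarrow> 'b::real_vector) \<Rightarrow> real^'k \<Rightarrow> 'b set" where
  "diff_image Du z = range (\<lambda>v::real^'k. \<Sum>i\<in>UNIV. v $ i *\<^sub>R Du i z)"

end

(* Write omega_xi(x) = xi - P(x) xi, where P(x) is the orthogonal projection onto V(x). The one-form
   v |-> omega_xi(x) . v is of class C^1 and annihilates V, and V is involutive at x as soon as
   D omega_xi(x)[v] . w is symmetric in v, w on V(x) for every xi. Pulling back by u, the hypothesis
   gives omega_xi(u) . d_i u = 0 a.e., and taking the curl of this identity in the sense of
   distributions yields the symmetry for v = d_j u, w = d_i u at almost every point: mollify u, use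
   that the second derivatives of the mollified map commute, and pass to the limit with the strong
   L^2 convergence of the mollified gradients (p > k >= 2; for k = 1 there is nothing to prove).
   Since the d_i u span V(u) a.e. and tangent C^1 fields are continuous along the continuous map u,
   the symmetry extends from almost every to every point. *)

theory Submission
  imports Defs
begin

section \<open>Smooth mollifiers\<close>

text \<open>The second derivatives of the mollified map meet only \<open>\<omega>\<close>,
  undifferentiated, and cancel by symmetry; what is left contains \<open>D\<omega>\<close> once and
  two first derivatives. Hence C^1 regularity of the projections suffices, but the expression is
  quadratic in the gradients, so that weak convergence of these would not identify the limit. The
  exponent enters as p >= 2, which puts the gradients in L^2 on compact boxes. The forms live on
  \<Omega> only, so the mollified map must stay in a compact part of \<Omega>; uniform continuity of
  \<open>u\<close> on a box provides this and makes \<open>D\<omega>\<close> along the mollified map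
  converge uniformly. The test functions are translated mollifiers as well: tested against them, the
  integrated identity says that every fine mollification of the symmetry defect vanishes, and L^1
  approximation turns this into vanishing almost everywhere. One family of bumps thus serves both
  purposes, and everything about approximation rests on the continuity of translations in L^1; the
  L^2 case is reduced to it by an elementary inequality.\<close>

definition flat :: "nat \<Rightarrow> real \<Rightarrow> real" where
  "flat n t = (if t > 0 then (1 / t) ^ n * exp (- (1 / t)) else 0)"

lemma flat_tendsto_0: "(flat n \<longlongrightarrow> 0) (at 0)"
proof -
  have "((\<lambda>t::real. inverse t ^ n / exp (inverse t)) \<longlongrightarrow> 0) (at_right 0)"
    by (rule filterlim_compose[OF tendsto_power_div_exp_0 filterlim_inverse_at_top_right])
  moreover have "eventually (\<lambda>t. inverse t ^ n / exp (inverse t) = flat n t) (at_right (0::real))"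
    by (simp add: eventually_at_filter flat_def exp_minus inverse_eq_divide)
  ultimately have r: "(flat n \<longlongrightarrow> 0) (at_right 0)"
    by (rule Lim_transform_eventually)
  have l: "(flat n \<longlongrightarrow> 0) (at_left 0)"
    by (rule tendsto_eventually) (simp add: eventually_at_filter flat_def)
  show ?thesis
    using filterlim_split_at[OF l r] .
qed

text \<open>\<open>flat 0\<close> is the classical exp (-1/t) extended by 0. Carrying powers of 1/t
  along makes the family closed under differentiation up to linear combinations, so one derivative
  formula yields derivatives of every order.\<close>

lemma flat_deriv:
  "(flat n has_real_derivative flat (n + 2) t - real n * flat (n + 1) t) (at t)"
proof -
  consider "t > 0" | "t < 0" | "t = 0" by linarith
  then show ?thesis
  proof cases
    case 1
    have "((\<lambda>t. (1 / t) ^ n * exp (- (1 / t))) has_real_derivative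
        flat (n + 2) t - real n * flat (n + 1) t) (at t)"
    proof -
      have s: "((\<lambda>t. 1 / t) has_real_derivative - (1 / t * (1 / t))) (at t)"
        using 1 by (auto intro!: derivative_eq_intros simp: field_simps)
      show ?thesis
        by (rule derivative_eq_intros s refl)+
          (use 1 in \<open>cases n; simp add: flat_def algebra_simps power_one_over\<close>)
    qed
    moreover have "eventually (\<lambda>s. flat n s = (1 / s) ^ n * exp (- (1 / s))) (nhds t)"
      using eventually_nhds_in_open[of "{0<..}" t] 1
      by (auto elim!: eventually_mono simp: flat_def)
    ultimately show ?thesis
      by (subst DERIV_cong_ev) auto
  next
    case 2
    have "eventually (\<lambda>s. flat n s = 0) (nhds t)"
      using eventually_nhds_in_open[of "{..<0}" t] 2
      by (auto elim!: eventually_mono simp: flat_def)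
    then show ?thesis
      using 2 by (subst DERIV_cong_ev[of _ _ _ "\<lambda>_. 0"]) (auto simp: flat_def)
  next
    case 3
    \<comment> \<open>Division by s raises the index by one, so the difference quotient at 0 is
      again a member of the family and \<open>flat_tendsto_0\<close> gives its limit.\<close>
    have "(flat n s - flat n 0) / (s - 0) = flat (Suc n) s" for s
      by (simp add: flat_def)
    then show ?thesis
      using flat_tendsto_0[of "Suc n"] 3
      by (simp add: has_field_derivative_iff flat_def[of _ 0])
  qed
qed

text \<open>A class that contains the bump, vanishes where \<bar>t\<bar> >= r and is stable under
  the product rule. Scalars in the base case are enough, since sums of such terms absorb every
  coefficient that differentiation creates.\<close>

inductive bump_like :: "real \<Rightarrow> (real \<Rightarrow> real) \<Rightarrow> bool" for r where
  base: "bump_like r (\<lambda>t. c * (flat m (r + t) * flat n (r - t)))"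
| add: "bump_like r f \<Longrightarrow> bump_like r g \<Longrightarrow> bump_like r (\<lambda>t. f t + g t)"

lemma bump_like_deriv:
  assumes "bump_like r f"
  shows "\<exists>f'. bump_like r f' \<and> (\<forall>t. (f has_real_derivative f' t) (at t))"
  using assms
proof induction
  case (base c m n)
  let ?f' = "\<lambda>t. (c * (flat (m+2) (r + t) * flat n (r - t)) + (- c * m) * (flat (m+1) (r + t) * flat n (r - t)))
    + ((- c) * (flat m (r + t) * flat (n+2) (r - t)) + (c * n) * (flat m (r + t) * flat (n+1) (r - t)))"
  have "((\<lambda>t. c * (flat m (r + t) * flat n (r - t))) has_real_derivative ?f' t) (at t)" for t
  proof -
    have l: "((\<lambda>t. flat m (r + t)) has_real_derivative (flat (m+2) (r + t) - m * flat (m+1) (r + t)) * 1) (at t)"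
      by (rule DERIV_chain2[OF flat_deriv]) (auto intro!: derivative_eq_intros)
    have u: "((\<lambda>t. flat n (r - t)) has_real_derivative (flat (n+2) (r - t) - n * flat (n+1) (r - t)) * - 1) (at t)"
      by (rule DERIV_chain2[OF flat_deriv]) (auto intro!: derivative_eq_intros)
    show ?thesis
      by (rule DERIV_cong[OF DERIV_cmult[OF DERIV_mult[OF l u]]]) (simp add: algebra_simps)
  qed
  moreover have "bump_like r ?f'"
    by (intro bump_like.intros)
  ultimately show ?case by blast
next
  case (add f g)
  then show ?case
    by (elim exE conjE) (rule exI, rule conjI, erule (1) bump_like.add, blast intro: DERIV_add)
qed

text \<open>\<open>D\<close> selects a derivative inside the class, and \<open>d n\<close> is its
  n-th iterate applied to exp (-1/(r+t)) exp (-1/(r-t)). The sequence form keeps all orders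
  available for products over coordinates.\<close>

lemma bump_sequence:
  assumes "r > 0"
  obtains d :: "nat \<Rightarrow> real \<Rightarrow> real" where
    "\<And>n t. (d n has_real_derivative d (Suc n) t) (at t)"
    "\<And>t. d 0 t \<ge> 0" "d 0 0 > 0" "\<And>t. \<bar>t\<bar> \<ge> r \<Longrightarrow> d 0 t = 0"
proof -
  define f0 where "f0 = (\<lambda>t. 1 * (flat 0 (r + t) * flat 0 (r - t)))"
  have "bump_like r f0"
    unfolding f0_def by (rule bump_like.base)
  obtain D where D: "\<And>f. bump_like r f \<Longrightarrow> bump_like r (D f)"
    "\<And>f t. bump_like r f \<Longrightarrow> (f has_real_derivative D f t) (at t)"
    using bump_like_deriv by metis
  define d where "d n = (D ^^ n) f0" for n
  have d_bump: "bump_like r (d n)" for n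
    by (induction n) (simp_all add: d_def \<open>bump_like r f0\<close> D(1))
  have d: "d 0 = f0" "\<And>n t. (d n has_real_derivative d (Suc n) t) (at t)"
    using D(2)[OF d_bump] by (simp_all add: d_def)
  show thesis
    using assms by (intro that[of d] d(2)) (auto simp: d(1) f0_def flat_def abs_if split: if_splits)
qed

text \<open>Convolution at x tests against y -> \<rho> (x - y), which has to be a test function. The
  scalar \<open>c\<close> is there for the induction: each differentiation of the reflected function
  brings out a factor -1.\<close>

lemma Cm_fun_reflect:
  assumes "Cm_fun m f"
  shows "Cm_fun m (\<lambda>y. c * f (x - y))"
  using assms
proof (induction m arbitrary: f c)
  case 0
  then have "continuous_on UNIV (\<lambda>y. f (x - y))"
    by (auto intro: continuous_on_compose2[of UNIV f] continuous_on_op_minus)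
  then show ?case
    by (simp add: continuous_on_mult_left)
next
  case (Suc m)
  then obtain D where D: "\<And>z. (f has_derivative (\<lambda>h. \<Sum>i\<in>UNIV. h $ i * D i z)) (at z)"
    "\<And>i. Cm_fun m (D i)"
    by auto
  have "((\<lambda>y. c * f (x - y)) has_derivative (\<lambda>h. \<Sum>i\<in>UNIV. h $ i * (- c * D i (x - z)))) (at z)" for z
  proof -
    have "((\<lambda>y. x - y) has_derivative uminus) (at z)"
      by (auto intro!: derivative_eq_intros)
    from has_derivative_mult_right[OF has_derivative_compose[OF this D(1)], of c]
    show ?thesis
      by (simp add: sum_distrib_left sum_negf algebra_simps)
  qed
  then show ?case
    using Suc.IH[OF D(2)] by (auto intro!: exI[of _ "\<lambda>i z. - c * D i (x - z)"])
qed

lemma has_derivative_prod_vec: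
  fixes f f' :: "'k::finite \<Rightarrow> real \<Rightarrow> real"
  assumes "\<And>l t. (f l has_real_derivative f' l t) (at t)"
  shows "((\<lambda>z::real^'k. \<Prod>l\<in>UNIV. f l (z $ l)) has_derivative
    (\<lambda>h. \<Sum>i\<in>UNIV. h $ i * (\<Prod>l\<in>UNIV. (if l = i then f' l else f l) (z $ l)))) (at z)"
proof -
  have "((\<lambda>z::real^'k. f l (z $ l)) has_derivative (\<lambda>h. f' l (z $ l) * h $ l)) (at z)" for l
    using has_derivative_compose[OF bounded_linear_imp_has_derivative[OF bounded_linear_vec_nth], of "f l" _ z l]
      assms[of l "z $ l"] by (auto simp: has_field_derivative_def)
  then have "((\<lambda>z::real^'k. \<Prod>l\<in>UNIV. f l (z $ l)) has_derivative
    (\<lambda>h. \<Sum>i\<in>UNIV. (f' i (z $ i) * h $ i) * (\<Prod>l\<in>UNIV - {i}. f l (z $ l)))) (at z)"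
    by (rule has_derivative_prod)
  moreover have "(\<Prod>l\<in>UNIV. (if l = i then f' l else f l) (z $ l)) = f' i (z $ i) * (\<Prod>l\<in>UNIV - {i}. f l (z $ l))" for i
    by (subst prod.remove[of _ i]) auto
  ultimately show ?thesis
    by (simp add: algebra_simps)
qed

text \<open>First and second partial derivatives are part of the data because the mollified map is
  differentiated twice under the integral; the symmetry of \<open>\<rho>''\<close> is what makes its
  second derivatives commute. The \<open>Cm_fun\<close> clause turns translates into test
  functions.\<close>

definition mollifier :: "real \<Rightarrow> (real^'k \<Rightarrow> real) \<Rightarrow> ('k \<Rightarrow> real^'k \<Rightarrow> real) \<Rightarrow> ('k \<Rightarrow> 'k \<Rightarrow> real^'k \<Rightarrow> real) \<Rightarrow> bool" where
  "mollifier \<delta> \<rho> \<rho>' \<rho>'' \<longleftrightarrow> (\<forall>m. Cm_fun m \<rho>) \<and>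
     (\<forall>z. (\<rho> has_derivative (\<lambda>h. \<Sum>i\<in>UNIV. h $ i * \<rho>' i z)) (at z)) \<and>
     (\<forall>i z. (\<rho>' i has_derivative (\<lambda>h. \<Sum>j\<in>UNIV. h $ j * \<rho>'' i j z)) (at z)) \<and>
     (\<forall>i j. continuous_on UNIV (\<rho>'' i j)) \<and> (\<forall>i j. \<rho>'' i j = \<rho>'' j i) \<and>
     (\<forall>z. \<rho> z \<ge> 0) \<and> (\<forall>z. norm z \<ge> \<delta> \<longrightarrow> \<rho> z = 0) \<and> integral\<^sup>L lborel \<rho> = 1"

lemma integral_pos_of_continuous:
  fixes f :: "'a::euclidean_space \<Rightarrow> real"
  assumes "continuous_on UNIV f" "\<And>x. f x \<ge> 0" "f a > 0" "integrable lborel f"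
  shows "integral\<^sup>L lborel f > 0"
proof (rule ccontr)
  assume "\<not> integral\<^sup>L lborel f > 0"
  moreover have "integral\<^sup>L lborel f \<ge> 0"
    using assms(2) by (simp add: integral_nonneg)
  ultimately have "integral\<^sup>L lborel f = 0"
    by simp
  then have ae: "AE x in lborel. f x = 0"
    using integral_nonneg_eq_0_iff_AE[OF assms(4)] assms(2) by simp
  have op: "open {x. f x \<noteq> 0}"
    by (rule open_Collect_neq[OF assms(1) continuous_on_const])
  have "emeasure lborel {x. f x \<noteq> 0} = 0"
    using AE_iff_measurable[of "{x. f x \<noteq> 0}" lborel "\<lambda>x. f x = 0"] op ae by (simp add: borel_open)
  then have "negligible {x. f x \<noteq> 0}"
    using op by (simp add: negligible_iff_null_sets null_sets_def)
  then show False
    using open_not_negligible[OF op] assms(3) by (metis (mono_tags) empty_iff mem_Collect_eq less_irrefl)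
qed

lemma mollifier_exists:
  assumes "\<delta> > 0"
  obtains \<rho> :: "real^'k \<Rightarrow> real" and \<rho>' \<rho>'' where "mollifier \<delta> \<rho> \<rho>' \<rho>''"
proof -
  \<comment> \<open>The norm is at most the sum of the absolute values of the coordinates; if all of
    these were below \<open>r\<close>, the norm would be below \<delta>.\<close>
  define r where "r = \<delta> / real CARD('k)"
  have r: "r > 0" using assms by (simp add: r_def)
  obtain d :: "nat \<Rightarrow> real \<Rightarrow> real" where
    d: "\<And>n t. (d n has_real_derivative d (Suc n) t) (at t)"
    and d0: "\<And>t. d 0 t \<ge> 0" "d 0 0 > 0" "\<And>t. \<bar>t\<bar> \<ge> r \<Longrightarrow> d 0 t = 0"
    using bump_sequence[OF r] by metis
  \<comment> \<open>\<kappa> is a multi-index: the factor in coordinate l is differentiated \<kappa>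
    l times. A partial derivative increments one entry of \<kappa>, and increments commute, which
    yields the symmetry of the second derivatives directly.\<close>
  define p where "p \<kappa> z = (\<Prod>l\<in>UNIV. d (\<kappa> l) (z $ l))" for \<kappa> and z :: "real^'k"
  have p_deriv: "(p \<kappa> has_derivative (\<lambda>h. \<Sum>i\<in>UNIV. h $ i * p (\<kappa>(i := Suc (\<kappa> i))) z)) (at z)" for \<kappa> z
  proof -
    have "d ((\<kappa>(i := Suc (\<kappa> i))) l) = (if l = i then d (Suc (\<kappa> l)) else d (\<kappa> l))" for i l
      by simp
    then show ?thesis
      unfolding p_def using has_derivative_prod_vec[of "\<lambda>l. d (\<kappa> l)" "\<lambda>l. d (Suc (\<kappa> l))" z] d by simp
  qed
  have p_cont: "continuous_on UNIV (p \<kappa>)" for \<kappa>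
    by (rule has_derivative_continuous_on[OF has_derivative_at_withinI[OF p_deriv]])
  have p_0: "p (\<lambda>_. 0) z = 0" if "norm z \<ge> \<delta>" for z :: "real^'k"
  proof -
    have "\<exists>l. \<bar>z $ l\<bar> \<ge> r"
    proof (rule ccontr)
      assume "\<not> ?thesis"
      then have "(\<Sum>l\<in>UNIV. \<bar>z $ l\<bar>) < (\<Sum>l\<in>(UNIV::'k set). r)"
        by (intro sum_strict_mono) (auto simp: not_le)
      then show False
        using norm_le_l1_cart[of z] that by (simp add: r_def)
    qed
    then show ?thesis
      unfolding p_def using d0(3) by (metis UNIV_I finite prod_zero)
  qed
  have p_int: "integrable lborel (p (\<lambda>_. 0))"
  proof -
    have "integrable lborel (\<lambda>z. indicator (cball 0 \<delta>) z *\<^sub>R p (\<lambda>_. 0) z)"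
      using borel_integrable_compact[OF compact_cball continuous_on_subset[OF p_cont subset_UNIV]] .
    moreover have "(\<lambda>z. indicator (cball 0 \<delta>) z *\<^sub>R p (\<lambda>_. 0) z) = p (\<lambda>_. 0)"
      using p_0 by (auto simp: indicator_def fun_eq_iff)
    ultimately show ?thesis by simp
  qed
  define I where "I = integral\<^sup>L lborel (p (\<lambda>_. 0))"
  have I: "I > 0"
    unfolding I_def
    by (rule integral_pos_of_continuous[of _ 0])
      (use p_cont p_int d0 in \<open>auto intro!: prod_nonneg simp: p_def\<close>)
  define q where "q \<kappa> z = p \<kappa> z / I" for \<kappa> z
  have q_deriv: "(q \<kappa> has_derivative (\<lambda>h. \<Sum>i\<in>UNIV. h $ i * q (\<kappa>(i := Suc (\<kappa> i))) z)) (at z)" for \<kappa> z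
    unfolding q_def[abs_def] using bounded_linear.has_derivative[OF bounded_linear_divide p_deriv]
    by (simp add: sum_divide_distrib)
  have q_cont: "continuous_on UNIV (q \<kappa>)" for \<kappa>
    using I unfolding q_def[abs_def] by (intro continuous_intros p_cont) auto
  have q_Cm: "Cm_fun m (q \<kappa>)" for m \<kappa>
  proof (induction m arbitrary: \<kappa>)
    case (Suc m)
    show ?case
      unfolding Cm_fun.simps
      by (intro exI[of _ "\<lambda>i. q (\<kappa>(i := Suc (\<kappa> i)))"] conjI allI q_deriv Suc.IH)
  qed (simp add: q_cont)
  \<comment> \<open>\<open>s i\<close> and \<open>t i j\<close> are the multi-indices e_i and e_i +
    e_j.\<close>
  define s where "s i = (\<lambda>_. 0)(i := Suc 0)" for i :: 'k
  define t where "t i j = (s i)(j := Suc (s i j))" for i j :: 'k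
  have "t i j = t j i" for i j
    by (auto simp: t_def s_def fun_eq_iff)
  moreover have "integral\<^sup>L lborel (q (\<lambda>_. 0)) = 1"
    using I by (simp add: q_def[abs_def] I_def)
  ultimately have "mollifier \<delta> (q (\<lambda>_. 0)) (\<lambda>i. q (s i)) (\<lambda>i j. q (t i j))"
    unfolding mollifier_def
    using q_Cm q_deriv[of "\<lambda>_. 0"] q_deriv[of "s _"] q_cont p_0 I
    by (auto simp: s_def[symmetric] t_def[symmetric] q_def p_def I_def[symmetric] d0 prod_nonneg)
  then show thesis by (rule that)
qed

section \<open>Continuity of translations in $L^1$\<close>

lemma nn_integral_lborel_translate:
  fixes f :: "'a::euclidean_space \<Rightarrow> ennreal"
  assumes [measurable]: "f \<in> borel_measurable borel"
  shows "(\<integral>\<^sup>+ x. f (x - y) \<partial>lborel) = (\<integral>\<^sup>+ x. f x \<partial>lborel)"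
proof -
  have "(\<integral>\<^sup>+ x. f x \<partial>lborel) = (\<integral>\<^sup>+ x. f x \<partial>distr lborel borel ((+) (- y)))"
    by (simp add: lborel_distr_plus)
  also have "\<dots> = (\<integral>\<^sup>+ x. f (x - y) \<partial>lborel)"
    by (subst nn_integral_distr) (auto simp: add.commute[of "- y"])
  finally show ?thesis ..
qed

lemma lborel_translate: "distr lborel borel (\<lambda>x::'a::euclidean_space. x - y) = lborel"
proof -
  have "(\<lambda>x::'a. x - y) = (+) (- y)" by auto
  then show ?thesis by (simp only: lborel_distr_plus)
qed

lemma integrable_lborel_translate:
  fixes f :: "'a::euclidean_space \<Rightarrow> 'b::euclidean_space"
  assumes "integrable lborel f"
  shows "integrable lborel (\<lambda>x. f (x - y))"
  using assms integrable_distr[of "\<lambda>x::'a. x - y" lborel borel f] by (simp add: lborel_translate)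

lemma integral_lborel_translate:
  fixes f :: "'a::euclidean_space \<Rightarrow> 'b::euclidean_space"
  assumes "f \<in> borel_measurable borel"
  shows "(\<integral>x. f (x - y) \<partial>lborel) = integral\<^sup>L lborel f"
  using assms integral_distr[of "\<lambda>x::'a. x - y" lborel borel f] by (simp add: lborel_translate)

lemma tendsto_0_ennrealI:
  fixes f :: "'a \<Rightarrow> ennreal"
  assumes "\<And>e. e > 0 \<Longrightarrow> eventually (\<lambda>x. f x < ennreal e) F"
  shows "(f \<longlongrightarrow> 0) F"
proof (rule order_tendstoI)
  fix a :: ennreal assume "0 < a"
  then obtain b where "0 < b" "b < a" using dense by blast
  then obtain e where "b = ennreal e" "e > 0"
    by (cases b) auto
  with assms[of e] \<open>b < a\<close> show "eventually (\<lambda>x. f x < a) F"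
    by (auto elim!: eventually_mono)
qed simp

text \<open>The L^1 distance between a function and its translate by y. Values in
  \<open>ennreal\<close> let the triangle inequalities hold without integrability.\<close>

definition shift_dist :: "('a::euclidean_space \<Rightarrow> 'b::euclidean_space) \<Rightarrow> 'a \<Rightarrow> ennreal" where
  "shift_dist f y = (\<integral>\<^sup>+ x. norm (f (x - y) - f x) \<partial>lborel)"

lemma shift_dist_le:
  fixes f g :: "'a::euclidean_space \<Rightarrow> 'b::euclidean_space"
  assumes [measurable]: "f \<in> borel_measurable borel" "g \<in> borel_measurable borel"
  shows "shift_dist f y \<le> shift_dist g y + 2 * (\<integral>\<^sup>+ x. norm (f x - g x) \<partial>lborel)"
proof -
  have "shift_dist f y \<le> (\<integral>\<^sup>+ x. ennreal (norm (g (x - y) - g x)) +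
      (ennreal (norm (f (x - y) - g (x - y))) + ennreal (norm (f x - g x))) \<partial>lborel)"
    unfolding shift_dist_def
  proof (rule nn_integral_mono)
    fix x
    have "norm (f (x - y) - f x) = norm ((g (x - y) - g x) + ((f (x - y) - g (x - y)) - (f x - g x)))"
      by (simp add: algebra_simps)
    also have "\<dots> \<le> norm (g (x - y) - g x) + (norm (f (x - y) - g (x - y)) + norm (f x - g x))"
      by (rule order_trans[OF norm_triangle_ineq add_left_mono[OF norm_triangle_ineq4]])
    finally show "ennreal (norm (f (x - y) - f x)) \<le> ennreal (norm (g (x - y) - g x)) +
      (ennreal (norm (f (x - y) - g (x - y))) + ennreal (norm (f x - g x)))"
      by (simp flip: ennreal_plus)
  qed
  also have "\<dots> = shift_dist g y + ((\<integral>\<^sup>+ x. norm (f (x - y) - g (x - y)) \<partial>lborel) + (\<integral>\<^sup>+ x. norm (f x - g x) \<partial>lborel))"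
    unfolding shift_dist_def by (simp add: nn_integral_add)
  also have "(\<integral>\<^sup>+ x. norm (f (x - y) - g (x - y)) \<partial>lborel) = (\<integral>\<^sup>+ x. norm (f x - g x) \<partial>lborel)"
    by (rule nn_integral_lborel_translate[of "\<lambda>x. ennreal (norm (f x - g x))"]) measurable
  finally show ?thesis
    by (simp add: mult_2)
qed

text \<open>Continuity of translations is inherited by L^1 limits: by \<open>shift_dist_le\<close>,
  replacing f by g costs twice their distance, once at x - y and once at x. With a distance of e/4
  the total stays below 3/4 e, leaving the strict inequality.\<close>

lemma shift_dist_approx:
  fixes f :: "'a::euclidean_space \<Rightarrow> 'b::euclidean_space"
  assumes [measurable]: "f \<in> borel_measurable borel"
    and "\<And>e. e > 0 \<Longrightarrow> \<exists>g \<in> borel_measurable borel. (shift_dist g \<longlongrightarrow> 0) (at 0) \<and>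
      (\<integral>\<^sup>+ x. norm (f x - g x) \<partial>lborel) \<le> ennreal e"
  shows "(shift_dist f \<longlongrightarrow> 0) (at 0)"
proof (rule tendsto_0_ennrealI)
  fix e :: real assume e: "e > 0"
  obtain g where g: "g \<in> borel_measurable borel" "(shift_dist g \<longlongrightarrow> 0) (at 0)"
      "(\<integral>\<^sup>+ x. norm (f x - g x) \<partial>lborel) \<le> ennreal (e / 4)"
    using assms(2)[of "e / 4"] e by auto
  have "eventually (\<lambda>y. shift_dist g y < ennreal (e / 4)) (at 0)"
    using order_tendstoD(2)[OF g(2), of "ennreal (e / 4)"] e by simp
  then show "eventually (\<lambda>y. shift_dist f y < ennreal e) (at 0)"
  proof eventually_elim
    case (elim y)
    have "shift_dist f y \<le> shift_dist g y + 2 * (\<integral>\<^sup>+ x. norm (f x - g x) \<partial>lborel)"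
      by (rule shift_dist_le) (use g in auto)
    also have "\<dots> \<le> shift_dist g y + 2 * ennreal (e / 4)"
      by (intro add_left_mono mult_left_mono g) auto
    also have "\<dots> \<le> ennreal (e / 4) + 2 * ennreal (e / 4)"
      using elim by (intro add_right_mono) auto
    also have "\<dots> = ennreal (3 / 4 * e)"
      using e by (simp flip: ennreal_numeral ennreal_mult ennreal_plus)
    also have "\<dots> < ennreal e"
      using e by (simp add: ennreal_less_iff)
    finally show ?case .
  qed
qed


text \<open>An argument in the manner of Scheffe. The positive part \<open>g n\<close> of 1_U(x) -
  1_U(x - Y n) is dominated by 1_U and tends to 0 everywhere: it is 0 off U, and openness handles
  the points of U. Since \<bar>a - b\<bar> = 2 max 0 (a - b) + (b - a) and the integral of b - a is
  0 by translation invariance, the positive part controls the whole distance; the boundary of U,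
  where the indicators need not converge, never matters.\<close>

lemma shift_dist_indicator_open:
  fixes U :: "'a::euclidean_space set" and c :: "'b::euclidean_space"
  assumes U: "open U" "emeasure lborel U < \<infinity>"
  shows "(shift_dist (\<lambda>x. indicator U x *\<^sub>R c) \<longlongrightarrow> 0) (at 0)"
  unfolding tendsto_at_iff_sequentially
proof (intro allI impI)
  fix Y :: "nat \<Rightarrow> 'a" assume Y: "Y \<longlonglongrightarrow> 0"
  let ?i = "indicator U :: 'a \<Rightarrow> real"
  have m[measurable]: "U \<in> sets borel" using U by simp
  have iI: "integrable lborel ?i" using U by (simp add: integrable_indicator_iff)
  note iT = integrable_lborel_translate[OF iI]
  define g where "g n x = max 0 (?i x - ?i (x - Y n))" for n x
  have gm[measurable]: "g n \<in> borel_measurable borel" for n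
    unfolding g_def[abs_def] by measurable
  have gI: "integrable lborel (g n)" for n
    unfolding g_def[abs_def] by (intro integrable_max Bochner_Integration.integrable_diff iI iT) auto
  have "(\<lambda>n. integral\<^sup>L lborel (g n)) \<longlonglongrightarrow> integral\<^sup>L lborel (\<lambda>x::'a. 0::real)"
  proof (rule integral_dominated_convergence[where w = ?i])
    show "AE x in lborel. (\<lambda>n. g n x) \<longlonglongrightarrow> 0"
    proof (rule AE_I2)
      fix x
      show "(\<lambda>n. g n x) \<longlonglongrightarrow> 0"
      proof (cases "x \<in> U")
        case True
        have "(\<lambda>n. x - Y n) \<longlonglongrightarrow> x - 0" by (intro tendsto_intros Y)
        then have "eventually (\<lambda>n. x - Y n \<in> U) sequentially"
          using U True by (auto intro: topological_tendstoD)
        then show ?thesis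
          using True by (auto intro!: tendsto_eventually elim!: eventually_mono simp: g_def)
      qed (auto simp: g_def)
    qed
  qed (use iI in \<open>auto simp: g_def indicator_def\<close>)
  then have lim: "(\<lambda>n. 2 * integral\<^sup>L lborel (g n) * norm c) \<longlonglongrightarrow> 2 * 0 * norm c"
    by (intro tendsto_intros) simp
  have "shift_dist (\<lambda>x. indicator U x *\<^sub>R c) (Y n) = ennreal (2 * integral\<^sup>L lborel (g n) * norm c)" for n
  proof -
    have "shift_dist (\<lambda>x. indicator U x *\<^sub>R c) (Y n) =
        (\<integral>\<^sup>+ x. ennreal ((2 * g n x + (?i (x - Y n) - ?i x)) * norm c) \<partial>lborel)"
      unfolding shift_dist_def
      by (intro nn_integral_cong arg_cong[where f = ennreal])
        (auto simp: g_def indicator_def split: if_splits)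
    also have "\<dots> = ennreal (\<integral>x. (2 * g n x + (?i (x - Y n) - ?i x)) * norm c \<partial>lborel)"
    proof (rule nn_integral_eq_integral)
      show "integrable lborel (\<lambda>x. (2 * g n x + (?i (x - Y n) - ?i x)) * norm c)"
        using gI[of n] iI iT[of "Y n"]
        by (intro integrable_mult_left Bochner_Integration.integrable_add integrable_mult_right
          Bochner_Integration.integrable_diff) assumption+
    qed (auto simp: g_def indicator_def)
    also have "(\<integral>x. (2 * g n x + (?i (x - Y n) - ?i x)) * norm c \<partial>lborel) =
        (2 * integral\<^sup>L lborel (g n) + ((\<integral>x. ?i (x - Y n) \<partial>lborel) - integral\<^sup>L lborel ?i)) * norm c"
      by (simp add: gI iI iT del: integral_indicator)
    also have "(\<integral>x. ?i (x - Y n) \<partial>lborel) = integral\<^sup>L lborel ?i"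
      by (rule integral_lborel_translate) simp
    finally show ?thesis by simp
  qed
  then show "(shift_dist (\<lambda>x. indicator U x *\<^sub>R c) \<circ> Y) \<longlonglongrightarrow> 0"
    using tendsto_ennrealI[OF lim] by (simp add: comp_def)
qed

text \<open>Outer regularity provides an open superset that is close to A in measure, and
  \<open>shift_dist_approx\<close> transfers the result from it.\<close>

lemma shift_dist_indicator:
  fixes A :: "'a::euclidean_space set" and c :: "'b::euclidean_space"
  assumes A[measurable]: "A \<in> sets borel" and fin: "emeasure lborel A < \<infinity>"
  shows "(shift_dist (\<lambda>x. indicator A x *\<^sub>R c) \<longlongrightarrow> 0) (at 0)"
proof (rule shift_dist_approx)
  fix e :: real assume e: "e > 0"
  \<comment> \<open>The summand 1 keeps the quotient meaningful for \<open>c = 0\<close>.\<close>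
  define e' where "e' = e / (norm c + 1)"
  have e': "e' > 0" "e' * norm c \<le> e"
    using e by (auto simp: e'_def field_simps add_pos_nonneg)
  obtain U where U: "open U" "A \<subseteq> U" "emeasure lborel (U - A) < e'"
    using outer_regular_lborel[OF A e'(1)] .
  have [measurable]: "U \<in> sets borel" using U by simp
  have "emeasure lborel U \<le> emeasure lborel A + emeasure lborel (U - A)"
    using emeasure_subadditive[of A lborel "U - A"] U(2) by (simp add: Un_absorb1)
  also have "\<dots> < \<infinity>"
    using fin U(3) by (auto simp: less_top[symmetric] top_unique)
  finally have fU: "emeasure lborel U < \<infinity>" .
  have "(\<integral>\<^sup>+ x. norm (indicator A x *\<^sub>R c - indicator U x *\<^sub>R c) \<partial>lborel) =
      (\<integral>\<^sup>+ x. ennreal (norm c) * indicator (U - A) x \<partial>lborel)"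
    using U(2) by (intro nn_integral_cong) (auto simp: indicator_def)
  also have "\<dots> = ennreal (norm c) * emeasure lborel (U - A)"
    by (simp add: nn_integral_cmult_indicator)
  also have "\<dots> \<le> ennreal (norm c) * ennreal e'"
    using U(3) by (intro mult_left_mono) auto
  also have "\<dots> \<le> ennreal e"
    using e' by (simp flip: ennreal_mult add: mult.commute ennreal_leI)
  finally show "\<exists>g \<in> borel_measurable borel. (shift_dist g \<longlongrightarrow> 0) (at 0) \<and>
      (\<integral>\<^sup>+ x. norm (indicator A x *\<^sub>R c - g x) \<partial>lborel) \<le> ennreal e"
    using shift_dist_indicator_open[OF U(1) fU, of c]
    by (intro bexI[of _ "\<lambda>x. indicator U x *\<^sub>R c"]) auto
qed measurable

lemma shift_dist_add_le:
  fixes f g :: "'a::euclidean_space \<Rightarrow> 'b::euclidean_space"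
  assumes [measurable]: "f \<in> borel_measurable borel" "g \<in> borel_measurable borel"
  shows "shift_dist (\<lambda>x. f x + g x) y \<le> shift_dist f y + shift_dist g y"
proof -
  have "shift_dist (\<lambda>x. f x + g x) y \<le>
      (\<integral>\<^sup>+ x. ennreal (norm (f (x - y) - f x)) + ennreal (norm (g (x - y) - g x)) \<partial>lborel)"
    unfolding shift_dist_def
    by (intro nn_integral_mono)
      (simp flip: ennreal_plus add: add_diff_add norm_triangle_ineq ennreal_leI)
  also have "\<dots> = shift_dist f y + shift_dist g y"
    unfolding shift_dist_def by (simp add: nn_integral_add)
  finally show ?thesis .
qed

lemma shift_dist_tendsto:
  fixes f :: "'a::euclidean_space \<Rightarrow> 'b::euclidean_space"
  assumes "integrable lborel f"
  shows "(shift_dist f \<longlongrightarrow> 0) (at 0)"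
  using assms
proof (induction rule: integrable_induct)
  case (base A c)
  then show ?case by (intro shift_dist_indicator) auto
next
  case (add f g)
  have "((\<lambda>y. shift_dist f y + shift_dist g y) \<longlongrightarrow> 0 + 0) (at 0)"
    by (intro tendsto_add add)
  then show ?case
    using tendsto_sandwich[of "\<lambda>_. 0" "shift_dist (\<lambda>x. f x + g x)" "at 0" "\<lambda>y. shift_dist f y + shift_dist g y" 0]
      shift_dist_add_le[of f g] add.hyps[THEN borel_measurable_integrable] by simp
next
  case (lim f s)
  have [measurable]: "f \<in> borel_measurable borel" "\<And>i. s i \<in> borel_measurable borel"
    using lim(1,4)[THEN borel_measurable_integrable] by auto
  have L: "(\<lambda>i. \<integral>\<^sup>+ x. norm (f x - s i x) \<partial>lborel) \<longlonglongrightarrow> 0"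
  proof (rule nn_integral_dominated_convergence_norm[where w = "\<lambda>x. 2 * norm (f x)"])
    show "(\<integral>\<^sup>+ x. ennreal (2 * norm (f x)) \<partial>lborel) < \<infinity>"
      using integrable_mult_right[OF integrable_norm[OF lim(4)], of 2] unfolding integrable_iff_bounded by simp
    show "AE x in lborel. norm (s j x) \<le> 2 * norm (f x)" for j
      using lim(3) by simp
    show "AE x in lborel. (\<lambda>i. s i x) \<longlonglongrightarrow> f x"
      using lim(2) by simp
  qed measurable
  show ?case
  proof (rule shift_dist_approx)
    fix e :: real assume "e > 0"
    then obtain i where "(\<integral>\<^sup>+ x. norm (f x - s i x) \<partial>lborel) < ennreal e"
      using order_tendstoD(2)[OF L, of "ennreal e"] by (auto simp: eventually_sequentially)
    then show "\<exists>g \<in> borel_measurable borel. (shift_dist g \<longlongrightarrow> 0) (at 0) \<and>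
      (\<integral>\<^sup>+ x. norm (f x - g x) \<partial>lborel) \<le> ennreal e"
      using lim(5) by (intro bexI[of _ "s i"] conjI less_imp_le) auto
  qed measurable
qed

lemma shift_dist_small:
  fixes f :: "'a::euclidean_space \<Rightarrow> 'b::euclidean_space"
  assumes "integrable lborel f" "e > 0"
  obtains \<delta> where "\<delta> > 0" "\<And>y. norm y < \<delta> \<Longrightarrow> shift_dist f y \<le> ennreal e"
proof -
  have "eventually (\<lambda>y. shift_dist f y < ennreal e) (at 0)"
    using order_tendstoD(2)[OF shift_dist_tendsto[OF assms(1)], of "ennreal e"] assms(2) by simp
  then obtain \<delta> where \<delta>: "\<delta> > 0" "\<And>y. y \<noteq> 0 \<Longrightarrow> norm y < \<delta> \<Longrightarrow> shift_dist f y < ennreal e"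
    by (auto simp: eventually_at dist_norm)
  \<comment> \<open>The filter \<open>at 0\<close> leaves out the point 0, which is supplied
    separately.\<close>
  moreover have "shift_dist f 0 = 0" by (simp add: shift_dist_def)
  ultimately show thesis
    by (intro that[of \<delta>]) (metis less_imp_le zero_le)+
qed

section \<open>Convergence of mollifications\<close>

definition conv :: "('a::euclidean_space \<Rightarrow> real) \<Rightarrow> ('a \<Rightarrow> 'b::euclidean_space) \<Rightarrow> 'a \<Rightarrow> 'b" where
  "conv \<rho> f x = (\<integral>y. \<rho> y *\<^sub>R f (x - y) \<partial>lborel)"

text \<open>The part of \<open>mollifier\<close> that the error estimates use, on any Euclidean
  space. Nonnegativity and unit mass make it a probability density, as the Jensen type inequalities
  below require.\<close>

definition kernel :: "real \<Rightarrow> ('a::euclidean_space \<Rightarrow> real) \<Rightarrow> bool" where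
  "kernel \<delta> \<rho> \<longleftrightarrow> continuous_on UNIV \<rho> \<and> (\<forall>z. \<rho> z \<ge> 0) \<and> (\<forall>z. norm z \<ge> \<delta> \<longrightarrow> \<rho> z = 0) \<and> integral\<^sup>L lborel \<rho> = 1"

lemma kernelD:
  assumes "kernel \<delta> \<rho>"
  shows "continuous_on UNIV \<rho>" "\<rho> z \<ge> 0" "norm z \<ge> \<delta> \<Longrightarrow> \<rho> z = 0" "integral\<^sup>L lborel \<rho> = 1"
    "\<rho> \<in> borel_measurable borel" "integrable lborel \<rho>" "(\<integral>\<^sup>+ y. \<rho> y \<partial>lborel) = 1"
proof -
  show *: "continuous_on UNIV \<rho>" "\<rho> z \<ge> 0" "norm z \<ge> \<delta> \<Longrightarrow> \<rho> z = 0" "integral\<^sup>L lborel \<rho> = 1" for z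
    using assms by (auto simp: kernel_def)
  show "\<rho> \<in> borel_measurable borel"
    using *(1) by (rule borel_measurable_continuous_onI)
  \<comment> \<open>The Bochner integral of a non-integrable function is 0 by convention, so an
    integral equal to 1 forces integrability.\<close>
  show i: "integrable lborel \<rho>"
    using *(4) by (metis not_integrable_integral_eq zero_neq_one)
  show "(\<integral>\<^sup>+ y. \<rho> y \<partial>lborel) = 1"
    using nn_integral_eq_integral[OF i] * by simp
qed

lemma kernel_bounded:
  assumes "kernel \<delta> \<rho>"
  obtains B where "\<And>z. norm (\<rho> z) \<le> B"
proof -
  have "compact (\<rho> ` cball 0 \<delta>)"
    by (intro compact_continuous_image continuous_on_subset[OF kernelD(1)[OF assms]]) auto
  then obtain B where B: "\<And>z. z \<in> cball 0 \<delta> \<Longrightarrow> norm (\<rho> z) \<le> B"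
    by (meson compact_imp_bounded bounded_iff imageI)
  have "norm (\<rho> z) \<le> max B 0" for z
    using B[of z] kernelD(3)[OF assms, of z] by (cases "norm z \<le> \<delta>") (auto simp: max_def)
  then show thesis by (rule that)
qed

lemma conv_integrable:
  fixes f :: "'a::euclidean_space \<Rightarrow> 'b::euclidean_space"
  assumes "kernel \<delta> \<rho>" "integrable lborel f"
  shows "integrable lborel (\<lambda>y. \<rho> y *\<^sub>R f (x - y))"
proof -
  have [measurable]: "\<rho> \<in> borel_measurable borel" "f \<in> borel_measurable borel"
    using kernelD(5)[OF assms(1)] assms(2) by auto
  obtain B where B: "\<And>z. norm (\<rho> z) \<le> B" using kernel_bounded[OF assms(1)] by metis
  have "integrable lborel (\<lambda>y. f (x + (-1) *\<^sub>R y))"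
  proof -
    have "lborel = density (distr lborel borel (\<lambda>y::'a. x + (-1) *\<^sub>R y)) (\<lambda>_. 1)"
      using lborel_affine[of "-1::real" x] by simp
    then have "distr lborel borel (\<lambda>y::'a. x + (-1) *\<^sub>R y) = lborel"
      by (simp add: density_1)
    then show ?thesis
      using integrable_distr[of "\<lambda>y::'a. x + (-1) *\<^sub>R y" lborel borel f] assms(2) by simp
  qed
  then have "integrable lborel (\<lambda>y. B *\<^sub>R f (x - y))"
    by simp
  then show ?thesis
  proof (rule Bochner_Integration.integrable_bound)
    have "\<bar>\<rho> y\<bar> * norm (f (x - y)) \<le> \<bar>B\<bar> * norm (f (x - y))" for y
      using B[of y] by (intro mult_right_mono) auto
    then show "AE y in lborel. norm (\<rho> y *\<^sub>R f (x - y)) \<le> norm (B *\<^sub>R f (x - y))"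
      by simp
  qed measurable
qed

lemma conv_diff:
  fixes f :: "'a::euclidean_space \<Rightarrow> 'b::euclidean_space"
  assumes "kernel \<delta> \<rho>" "integrable lborel f"
  shows "conv \<rho> f x - f x = (\<integral>y. \<rho> y *\<^sub>R (f (x - y) - f x) \<partial>lborel)"
    and "integrable lborel (\<lambda>y. \<rho> y *\<^sub>R (f (x - y) - f x))"
proof -
  have i: "integrable lborel (\<lambda>y. \<rho> y *\<^sub>R f x)"
    using kernelD(6)[OF assms(1)] by simp
  note j = conv_integrable[OF assms, of x]
  have "(\<integral>y. \<rho> y *\<^sub>R f x \<partial>lborel) = f x"
    using integral_scaleR_left[OF kernelD(6)[OF assms(1)], of "f x"] kernelD(4)[OF assms(1)] by simp
  then show "conv \<rho> f x - f x = (\<integral>y. \<rho> y *\<^sub>R (f (x - y) - f x) \<partial>lborel)"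
    unfolding conv_def using Bochner_Integration.integral_diff[OF j i] by (simp add: scaleR_diff_right)
  show "integrable lborel (\<lambda>y. \<rho> y *\<^sub>R (f (x - y) - f x))"
    using Bochner_Integration.integrable_diff[OF j i] by (simp add: scaleR_diff_right)
qed

text \<open>The common part of the L^1 and L^2 estimates, with \<Phi> the norm or its square. The
  Jensen inequality is assumed pointwise; exchanging the integrals turns it into an average of
  translation errors with weight \<rho>, and only translations shorter than \<delta> carry
  weight.\<close>

lemma conv_error_le:
  fixes f :: "'a::euclidean_space \<Rightarrow> 'b::euclidean_space" and \<Phi> :: "'b \<Rightarrow> ennreal"
  assumes k: "kernel \<delta> \<rho>" and [measurable]: "f \<in> borel_measurable borel" "\<Phi> \<in> borel_measurable borel"
    and jensen: "\<And>x. \<Phi> (conv \<rho> f x - f x) \<le> (\<integral>\<^sup>+ y. ennreal (\<rho> y) * \<Phi> (f (x - y) - f x) \<partial>lborel)"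
    and shift: "\<And>y. norm y < \<delta> \<Longrightarrow> (\<integral>\<^sup>+ x. \<Phi> (f (x - y) - f x) \<partial>lborel) \<le> e"
  shows "(\<integral>\<^sup>+ x. \<Phi> (conv \<rho> f x - f x) \<partial>lborel) \<le> e"
proof -
  have [measurable]: "\<rho> \<in> borel_measurable borel"
    using kernelD(5)[OF k] .
  have "(\<integral>\<^sup>+ x. \<Phi> (conv \<rho> f x - f x) \<partial>lborel) \<le>
      (\<integral>\<^sup>+ x. (\<integral>\<^sup>+ y. ennreal (\<rho> y) * \<Phi> (f (x - y) - f x) \<partial>lborel) \<partial>lborel)"
    by (intro nn_integral_mono jensen)
  also have "\<dots> = (\<integral>\<^sup>+ y. (\<integral>\<^sup>+ x. ennreal (\<rho> y) * \<Phi> (f (x - y) - f x) \<partial>lborel) \<partial>lborel)"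
    by (rule lborel_pair.Fubini') measurable
  also have "\<dots> \<le> (\<integral>\<^sup>+ y. ennreal (\<rho> y) * e \<partial>lborel)"
  proof (rule nn_integral_mono)
    fix y
    have "(\<integral>\<^sup>+ x. ennreal (\<rho> y) * \<Phi> (f (x - y) - f x) \<partial>lborel) = ennreal (\<rho> y) * (\<integral>\<^sup>+ x. \<Phi> (f (x - y) - f x) \<partial>lborel)"
      by (rule nn_integral_cmult) measurable
    also have "\<dots> \<le> ennreal (\<rho> y) * e"
      using shift[of y] kernelD(3)[OF k, of y] by (cases "norm y < \<delta>") (auto intro!: mult_left_mono)
    finally show "(\<integral>\<^sup>+ x. ennreal (\<rho> y) * \<Phi> (f (x - y) - f x) \<partial>lborel) \<le> ennreal (\<rho> y) * e" .
  qed
  also have "\<dots> = e"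
    using kernelD(7)[OF k] by (simp add: nn_integral_multc)
  finally show ?thesis .
qed

lemma conv_L1_error:
  fixes f :: "'a::euclidean_space \<Rightarrow> 'b::euclidean_space"
  assumes k: "kernel \<delta> \<rho>" and f: "integrable lborel f"
    and "\<And>y. norm y < \<delta> \<Longrightarrow> shift_dist f y \<le> e"
  shows "(\<integral>\<^sup>+ x. norm (conv \<rho> f x - f x) \<partial>lborel) \<le> e"
proof (rule conv_error_le[OF k, where \<Phi> = "\<lambda>v. ennreal (norm v)"])
  fix x
  have "ennreal (norm (conv \<rho> f x - f x)) \<le> (\<integral>\<^sup>+ y. norm (\<rho> y *\<^sub>R (f (x - y) - f x)) \<partial>lborel)"
    unfolding conv_diff(1)[OF k f] by (rule integral_norm_bound_ennreal[OF conv_diff(2)[OF k f]])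
  also have "\<dots> = (\<integral>\<^sup>+ y. ennreal (\<rho> y) * norm (f (x - y) - f x) \<partial>lborel)"
    using kernelD(2)[OF k] by (simp add: ennreal_mult)
  finally show "ennreal (norm (conv \<rho> f x - f x)) \<le> \<dots>" .
qed (use assms(3) f in \<open>auto simp: shift_dist_def\<close>)

text \<open>Reduces translation continuity in $L^2$ for \<open>f\<close> to translation continuity in $L^1$ for \<open>|f| f\<close>.\<close>

lemma norm_diff_square_le:
  fixes v w :: "'b::real_inner"
  shows "(norm (v - w))\<^sup>2 \<le> 2 * norm (norm v *\<^sub>R v - norm w *\<^sub>R w)"
proof (cases "v = w")
  case False
  let ?s = "norm v *\<^sub>R v - norm w *\<^sub>R w"
  \<comment> \<open>Both sides equal a^3 + b^3 - (a + b) (v \<bullet> w) with a, b the norms of v,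
    w. Dropping the last square and using norm (v - w) \<le> a + b gives a cubic lower bound;
    Cauchy-Schwarz then allows division by norm (v - w).\<close>
  have "?s \<bullet> (v - w) = (norm v + norm w) / 2 * (norm (v - w))\<^sup>2 + (norm v + norm w) / 2 * (norm v - norm w)\<^sup>2"
    by (simp add: power2_norm_eq_inner inner_diff inner_commute algebra_simps flip: power2_eq_square)
      (simp add: power2_norm_eq_inner[symmetric] power2_eq_square algebra_simps add_divide_distrib diff_divide_distrib)
  also have "\<dots> \<ge> norm (v - w) / 2 * (norm (v - w))\<^sup>2"
  proof -
    have "norm (v - w) / 2 * (norm (v - w))\<^sup>2 \<le> (norm v + norm w) / 2 * (norm (v - w))\<^sup>2"
      using norm_triangle_ineq4[of v w] by (intro mult_right_mono) auto
    moreover have "0 \<le> (norm v + norm w) / 2 * (norm v - norm w)\<^sup>2"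
      by simp
    ultimately show ?thesis by linarith
  qed
  finally have "norm (v - w) / 2 * (norm (v - w))\<^sup>2 \<le> norm ?s * norm (v - w)"
    using Cauchy_Schwarz_ineq2[of ?s "v - w"] by linarith
  then show ?thesis
    using False by (simp add: power2_eq_square field_simps)
qed simp

text \<open>Jensen's inequality for the square without convexity theory: with m the mean, expanding
  \<rho> times the square of norm (g - m) gives 2 g \<bullet> m - m \<bullet> m \<le> g \<bullet> g
  under the weight \<rho>, and the integral of the left side is m \<bullet> m. If the right-hand
  integral is infinite, the claim is trivial.\<close>

lemma norm_integral_square_le:
  fixes g :: "'a::euclidean_space \<Rightarrow> 'b::euclidean_space"
  assumes k: "kernel \<delta> \<rho>" and g[measurable]: "g \<in> borel_measurable borel"
    and i: "integrable lborel (\<lambda>y. \<rho> y *\<^sub>R g y)"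
  shows "ennreal ((norm (\<integral>y. \<rho> y *\<^sub>R g y \<partial>lborel))\<^sup>2) \<le> (\<integral>\<^sup>+ y. ennreal (\<rho> y) * ennreal ((norm (g y))\<^sup>2) \<partial>lborel)"
proof -
  have [measurable]: "\<rho> \<in> borel_measurable borel"
    using kernelD(5)[OF k] .
  define m where "m = (\<integral>y. \<rho> y *\<^sub>R g y \<partial>lborel)"
  have j1: "integrable lborel (\<lambda>y. 2 * ((\<rho> y *\<^sub>R g y) \<bullet> m))"
    by (rule integrable_mult_right[OF integrable_inner_left[OF i]])
  have j2: "integrable lborel (\<lambda>y. \<rho> y * (norm m)\<^sup>2)"
    using kernelD(6)[OF k] by simp
  note j = Bochner_Integration.integrable_diff[OF j1 j2]
  have "(norm m)\<^sup>2 = 2 * (m \<bullet> m) - (norm m)\<^sup>2"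
    by (simp add: power2_norm_eq_inner)
  also have "m \<bullet> m = (\<integral>y. (\<rho> y *\<^sub>R g y) \<bullet> m \<partial>lborel)"
    using integral_inner_left[OF i, of m] by (simp add: m_def)
  also have "2 * \<dots> - (norm m)\<^sup>2 = (\<integral>y. 2 * ((\<rho> y *\<^sub>R g y) \<bullet> m) - \<rho> y * (norm m)\<^sup>2 \<partial>lborel)"
    unfolding Bochner_Integration.integral_diff[OF j1 j2] using kernelD(4)[OF k] by simp
  finally have "ennreal ((norm m)\<^sup>2) = ennreal (\<integral>y. 2 * ((\<rho> y *\<^sub>R g y) \<bullet> m) - \<rho> y * (norm m)\<^sup>2 \<partial>lborel)"
    by simp
  also have "\<dots> \<le> (\<integral>\<^sup>+ y. ennreal (\<rho> y) * ennreal ((norm (g y))\<^sup>2) \<partial>lborel)"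
  proof (cases "(\<integral>\<^sup>+ y. ennreal (\<rho> y) * ennreal ((norm (g y))\<^sup>2) \<partial>lborel) = \<infinity>")
    case False
    have l: "integrable lborel (\<lambda>y. \<rho> y * (norm (g y))\<^sup>2)"
      using False kernelD(2)[OF k] by (intro integrableI_nonneg) (auto simp: ennreal_mult top.not_eq_extremum)
    have "2 * ((\<rho> y *\<^sub>R g y) \<bullet> m) - \<rho> y * (norm m)\<^sup>2 \<le> \<rho> y * (norm (g y))\<^sup>2" for y
    proof -
      have "0 \<le> \<rho> y * (norm (g y - m))\<^sup>2"
        using kernelD(2)[OF k] by simp
      then show ?thesis
        by (simp add: power2_norm_eq_inner inner_diff inner_commute algebra_simps)
    qed
    then have "(\<integral>y. 2 * ((\<rho> y *\<^sub>R g y) \<bullet> m) - \<rho> y * (norm m)\<^sup>2 \<partial>lborel) \<le> (\<integral>y. \<rho> y * (norm (g y))\<^sup>2 \<partial>lborel)"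
      by (intro integral_mono j l)
    also have "ennreal \<dots> = (\<integral>\<^sup>+ y. ennreal (\<rho> y) * ennreal ((norm (g y))\<^sup>2) \<partial>lborel)"
      using kernelD(2)[OF k] by (subst nn_integral_eq_integral[OF l, symmetric]) (auto simp: ennreal_mult)
    finally show ?thesis by (simp add: ennreal_leI)
  qed simp
  finally show ?thesis unfolding m_def .
qed

lemma conv_L2_error:
  fixes f :: "'a::euclidean_space \<Rightarrow> 'b::euclidean_space"
  assumes k: "kernel \<delta> \<rho>" and f: "integrable lborel f"
    and shift: "\<And>y. norm y < \<delta> \<Longrightarrow> shift_dist (\<lambda>x. norm (f x) *\<^sub>R f x) y \<le> e"
  shows "(\<integral>\<^sup>+ x. ennreal ((norm (conv \<rho> f x - f x))\<^sup>2) \<partial>lborel) \<le> 2 * e"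
proof (rule conv_error_le[OF k, where \<Phi> = "\<lambda>v. ennreal ((norm v)\<^sup>2)"])
  have [measurable]: "f \<in> borel_measurable borel" using f by auto
  then show "f \<in> borel_measurable borel" .
  fix x
  show "ennreal ((norm (conv \<rho> f x - f x))\<^sup>2) \<le> (\<integral>\<^sup>+ y. ennreal (\<rho> y) * ennreal ((norm (f (x - y) - f x))\<^sup>2) \<partial>lborel)"
    unfolding conv_diff(1)[OF k f]
    by (rule norm_integral_square_le[OF k _ conv_diff(2)[OF k f]]) measurable
next
  fix y :: 'a assume y: "norm y < \<delta>"
  have [measurable]: "f \<in> borel_measurable borel" using f by auto
  have "(\<integral>\<^sup>+ x. ennreal ((norm (f (x - y) - f x))\<^sup>2) \<partial>lborel) \<le>
      (\<integral>\<^sup>+ x. 2 * ennreal (norm (norm (f (x - y)) *\<^sub>R f (x - y) - norm (f x) *\<^sub>R f x)) \<partial>lborel)"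
    by (intro nn_integral_mono)
      (simp flip: ennreal_numeral ennreal_mult add: ennreal_leI norm_diff_square_le)
  also have "\<dots> = 2 * shift_dist (\<lambda>x. norm (f x) *\<^sub>R f x) y"
    unfolding shift_dist_def by (rule nn_integral_cmult) measurable
  also have "\<dots> \<le> 2 * e"
    by (intro mult_left_mono shift y) simp
  finally show "(\<integral>\<^sup>+ x. ennreal ((norm (f (x - y) - f x))\<^sup>2) \<partial>lborel) \<le> 2 * e" .
qed simp

section \<open>Limits of quadratic expressions and integration by parts\<close>

lemma norm_square_le_double:
  fixes v w :: "'a::real_normed_vector"
  shows "(norm v)\<^sup>2 \<le> 2 * (norm w)\<^sup>2 + 2 * (norm (v - w))\<^sup>2"
proof -
  have "norm v \<le> norm w + norm (v - w)"
    using norm_triangle_ineq[of w "v - w"] by simp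
  then have "(norm v)\<^sup>2 \<le> (norm w + norm (v - w))\<^sup>2"
    by (intro power_mono) auto
  also have "\<dots> \<le> 2 * (norm w)\<^sup>2 + 2 * (norm (v - w))\<^sup>2"
    using sum_squares_bound[of "norm w" "norm (v - w)"] by (simp add: power2_sum)
  finally show ?thesis .
qed

text \<open>The integrands converge in L^1. Their difference is split so that each summand contains
  one difference, of \<open>B\<close>, \<open>f\<close> or \<open>g\<close>. Products are then
  separated by a weighted arithmetic-geometric inequality: the fixed norms of \<open>f\<close> and
  \<open>g\<close> get coefficients of order t, while the errors get coefficients of order 1/t but
  are themselves eventually below \<open>t\<^sup>2\<close>. The norms of \<open>f' n\<close> and
  \<open>g' n\<close> are bounded through those of the limits.\<close>

lemma L2_blinfun_limit:
  fixes B :: "'a \<Rightarrow> ('b::euclidean_space \<Rightarrow>\<^sub>L 'c::euclidean_space)"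
  assumes [measurable]: "\<And>n. f' n \<in> borel_measurable M" "f \<in> borel_measurable M"
      "\<And>n. g' n \<in> borel_measurable M" "g \<in> borel_measurable M"
    and fin: "(\<integral>\<^sup>+ x. ennreal ((norm (f x))\<^sup>2) \<partial>M) < \<infinity>" "(\<integral>\<^sup>+ x. ennreal ((norm (g x))\<^sup>2) \<partial>M) < \<infinity>"
    and lim: "(\<lambda>n. \<integral>\<^sup>+ x. ennreal ((norm (f' n x - f x))\<^sup>2) \<partial>M) \<longlonglongrightarrow> 0"
      "(\<lambda>n. \<integral>\<^sup>+ x. ennreal ((norm (g' n x - g x))\<^sup>2) \<partial>M) \<longlonglongrightarrow> 0"
    and unif: "uniform_limit (space M) B' B sequentially"
    and bound: "\<And>x. x \<in> space M \<Longrightarrow> norm (B x) \<le> C"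
    and meas[measurable]: "(\<lambda>x. B x (f x) \<bullet> g x) \<in> borel_measurable M"
    and int: "\<And>n. integrable M (\<lambda>x. B' n x (f' n x) \<bullet> g' n x)"
  shows "integrable M (\<lambda>x. B x (f x) \<bullet> g x)"
    and "(\<lambda>n. \<integral>x. B' n x (f' n x) \<bullet> g' n x \<partial>M) \<longlonglongrightarrow> (\<integral>x. B x (f x) \<bullet> g x \<partial>M)"
proof -
  have [measurable]: "(\<lambda>x. B' n x (f' n x) \<bullet> g' n x) \<in> borel_measurable M" for n
    using int[of n] by auto
  obtain a where a: "(\<integral>\<^sup>+ x. ennreal ((norm (f x))\<^sup>2) \<partial>M) = ennreal a" "a \<ge> 0"
    using fin(1) by (auto simp: less_top_ennreal)
  obtain b where b: "(\<integral>\<^sup>+ x. ennreal ((norm (g x))\<^sup>2) \<partial>M) = ennreal b" "b \<ge> 0"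
    using fin(2) by (auto simp: less_top_ennreal)
  define C' where "C' = max C 0"
  have C': "C' \<ge> 0" "\<And>x. x \<in> space M \<Longrightarrow> norm (B x) \<le> C'"
    using order_trans[OF bound max.cobounded1] by (auto simp: C'_def)
  \<comment> \<open>The weight t is kept free so that the factor belonging to the limit function can
    be made small at the expense of the error factor.\<close>
  have amgm: "p * q \<le> t * p\<^sup>2 + q\<^sup>2 / t" if "t > 0" for p q t :: real
  proof -
    have "0 \<le> (t * p - q / 2)\<^sup>2 / t + 3 / 4 * q\<^sup>2 / t"
      using that by simp
    also have "\<dots> = t * p\<^sup>2 - p * q + q\<^sup>2 / t"
      using that by (simp add: power2_eq_square field_simps)
    finally show ?thesis by simp
  qed
  have bd: "norm (B' n x (f' n x) \<bullet> g' n x - B x (f x) \<bullet> g x) \<le>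
      (2 * t + C' * t) * (norm (f x))\<^sup>2 + (2 * t + 2 * C' * t) * (norm (g x))\<^sup>2 +
      (2 * t + C' / t) * (norm (f' n x - f x))\<^sup>2 + (2 * t + 2 * C' * t + C' / t) * (norm (g' n x - g x))\<^sup>2"
    if t: "t > 0" and x: "x \<in> space M" and u: "norm (B' n x - B x) \<le> t" for n x t
  proof -
    let ?F = "norm (f x)" and ?G = "norm (g x)" and ?p = "norm (f' n x - f x)" and ?q = "norm (g' n x - g x)"
    have eq: "B' n x (f' n x) \<bullet> g' n x - B x (f x) \<bullet> g x =
        (B' n x - B x) (f' n x) \<bullet> g' n x + (B x (f' n x - f x) \<bullet> g' n x + B x (f x) \<bullet> (g' n x - g x))"
      by (simp add: blinfun.diff_left blinfun.diff_right inner_diff_left inner_diff_right)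
    have "norm (B' n x (f' n x) \<bullet> g' n x - B x (f x) \<bullet> g x) \<le> norm ((B' n x - B x) (f' n x)) * norm (g' n x) +
        (norm (B x (f' n x - f x)) * norm (g' n x) + norm (B x (f x)) * ?q)"
      unfolding real_norm_def eq
      by (intro order_trans[OF abs_triangle_ineq] add_mono Cauchy_Schwarz_ineq2)
    also have "\<dots> \<le> (t * norm (f' n x)) * norm (g' n x) + ((C' * ?p) * norm (g' n x) + (C' * ?F) * ?q)"
      using u C'(2)[OF x]
      by (intro add_mono mult_right_mono order_trans[OF norm_blinfun]) auto
    also have "\<dots> = t * (norm (f' n x) * norm (g' n x)) + C' * (norm (g' n x) * ?p + ?F * ?q)"
      by (simp add: algebra_simps)
    also have "\<dots> \<le> t * ((2 * ?F\<^sup>2 + 2 * ?p\<^sup>2) + (2 * ?G\<^sup>2 + 2 * ?q\<^sup>2)) +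
        C' * ((t * (2 * ?G\<^sup>2 + 2 * ?q\<^sup>2) + ?p\<^sup>2 / t) + (t * ?F\<^sup>2 + ?q\<^sup>2 / t))"
    proof (intro add_mono mult_left_mono)
      have "norm (f' n x) * norm (g' n x) \<le> (norm (f' n x))\<^sup>2 + (norm (g' n x))\<^sup>2"
        using amgm[of 1] by simp
      then show "norm (f' n x) * norm (g' n x) \<le> (2 * ?F\<^sup>2 + 2 * ?p\<^sup>2) + (2 * ?G\<^sup>2 + 2 * ?q\<^sup>2)"
        using norm_square_le_double[of "f' n x" "f x"] norm_square_le_double[of "g' n x" "g x"] by linarith
      have "norm (g' n x) * ?p \<le> t * (norm (g' n x))\<^sup>2 + ?p\<^sup>2 / t"
        by (rule amgm[OF t])
      also have "\<dots> \<le> t * (2 * ?G\<^sup>2 + 2 * ?q\<^sup>2) + ?p\<^sup>2 / t"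
        using t norm_square_le_double[of "g' n x" "g x"] by (intro add_right_mono mult_left_mono) auto
      finally show "norm (g' n x) * ?p \<le> t * (2 * ?G\<^sup>2 + 2 * ?q\<^sup>2) + ?p\<^sup>2 / t" .
      show "?F * ?q \<le> t * ?F\<^sup>2 + ?q\<^sup>2 / t"
        by (rule amgm[OF t])
    qed (use t C' in auto)
    finally show ?thesis
      by (simp add: algebra_simps)
  qed
  \<comment> \<open>Inserting the bound \<open>t\<^sup>2\<close> for both squared errors and using t
    \<le> 1, the four terms add up to at most t times this constant; \<open>a\<close> and
    \<open>b\<close> are the squared L^2 norms of f and g.\<close>
  define K where "K = (2 + C') * a + (2 + 2 * C') * b + (4 + 4 * C') + 1"
  have K: "K > 0"
    unfolding K_def using a b C' by (intro add_nonneg_pos add_nonneg_nonneg mult_nonneg_nonneg) auto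
  have est: "eventually (\<lambda>n. (\<integral>\<^sup>+ x. norm (B' n x (f' n x) \<bullet> g' n x - B x (f x) \<bullet> g x) \<partial>M) \<le> ennreal (t * K)) sequentially"
    if t: "t > 0" "t \<le> 1" for t
  proof -
    have "eventually (\<lambda>n. \<forall>x\<in>space M. dist (B' n x) (B x) < t) sequentially"
      using uniform_limitD[OF unif t(1)] .
    moreover have "eventually (\<lambda>n. (\<integral>\<^sup>+ x. ennreal ((norm (f' n x - f x))\<^sup>2) \<partial>M) < ennreal (t\<^sup>2)) sequentially"
      using order_tendstoD(2)[OF lim(1)] t by simp
    moreover have "eventually (\<lambda>n. (\<integral>\<^sup>+ x. ennreal ((norm (g' n x - g x))\<^sup>2) \<partial>M) < ennreal (t\<^sup>2)) sequentially"
      using order_tendstoD(2)[OF lim(2)] t by simp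
    ultimately show ?thesis
    proof eventually_elim
      case (elim n)
      have nn: "0 \<le> 2 * t + C' * t" "0 \<le> 2 * t + 2 * C' * t" "0 \<le> 2 * t + C' / t" "0 \<le> 2 * t + 2 * C' * t + C' / t"
        using t C' by simp_all
      have "(\<integral>\<^sup>+ x. norm (B' n x (f' n x) \<bullet> g' n x - B x (f x) \<bullet> g x) \<partial>M) \<le>
        (\<integral>\<^sup>+ x. ennreal (2 * t + C' * t) * ennreal ((norm (f x))\<^sup>2) + ennreal (2 * t + 2 * C' * t) * ennreal ((norm (g x))\<^sup>2) +
          ennreal (2 * t + C' / t) * ennreal ((norm (f' n x - f x))\<^sup>2) +
          ennreal (2 * t + 2 * C' * t + C' / t) * ennreal ((norm (g' n x - g x))\<^sup>2) \<partial>M)"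
      proof (rule nn_integral_mono)
        fix x assume x: "x \<in> space M"
        have "norm (B' n x - B x) \<le> t"
          using elim(1) x by (auto simp: dist_norm intro: less_imp_le)
        from ennreal_leI[OF bd[OF t(1) x this]]
        show "ennreal (norm (B' n x (f' n x) \<bullet> g' n x - B x (f x) \<bullet> g x)) \<le>
          ennreal (2 * t + C' * t) * ennreal ((norm (f x))\<^sup>2) + ennreal (2 * t + 2 * C' * t) * ennreal ((norm (g x))\<^sup>2) +
          ennreal (2 * t + C' / t) * ennreal ((norm (f' n x - f x))\<^sup>2) +
          ennreal (2 * t + 2 * C' * t + C' / t) * ennreal ((norm (g' n x - g x))\<^sup>2)"
          using nn by (simp add: ennreal_mult ennreal_plus del: distrib_right_numeral)
      qed
      also have "\<dots> = ennreal (2 * t + C' * t) * ennreal a + ennreal (2 * t + 2 * C' * t) * ennreal b +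
          ennreal (2 * t + C' / t) * (\<integral>\<^sup>+ x. ennreal ((norm (f' n x - f x))\<^sup>2) \<partial>M) +
          ennreal (2 * t + 2 * C' * t + C' / t) * (\<integral>\<^sup>+ x. ennreal ((norm (g' n x - g x))\<^sup>2) \<partial>M)"
        by (simp add: nn_integral_add nn_integral_cmult a b)
      also have "\<dots> \<le> ennreal (2 * t + C' * t) * ennreal a + ennreal (2 * t + 2 * C' * t) * ennreal b +
          ennreal (2 * t + C' / t) * ennreal (t\<^sup>2) + ennreal (2 * t + 2 * C' * t + C' / t) * ennreal (t\<^sup>2)"
        using elim by (intro add_mono mult_left_mono) auto
      also have "\<dots> = ennreal ((2 * t + C' * t) * a + (2 * t + 2 * C' * t) * b + (2 * t + C' / t) * t\<^sup>2 + (2 * t + 2 * C' * t + C' / t) * t\<^sup>2)"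
        using nn a b by (simp add: ennreal_mult ennreal_plus del: distrib_right_numeral)
      also have "\<dots> \<le> ennreal (t * K)"
      proof (rule ennreal_leI)
        have tt: "t * t\<^sup>2 \<le> t" "C' * (t * t\<^sup>2) \<le> C' * t"
          using t C' by (auto intro!: mult_left_mono simp: power_le_one mult_left_le)
        have "(2 * t + C' / t) * t\<^sup>2 = 2 * (t * t\<^sup>2) + C' * t"
          "(2 * t + 2 * C' * t + C' / t) * t\<^sup>2 = 2 * (t * t\<^sup>2) + 2 * (C' * (t * t\<^sup>2)) + C' * t"
          using t by (auto simp: field_simps power2_eq_square)
        moreover have gen: "X = 2 * s + d \<Longrightarrow> Y = 2 * s + 2 * c + d \<Longrightarrow> s \<le> t \<Longrightarrow> c \<le> d \<Longrightarrow> 0 \<le> t \<Longrightarrow> 0 \<le> d \<Longrightarrow>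
            P + Q + X + Y \<le> P + Q + 4 * t + 4 * d + t" for P Q X Y s c d :: real
          by linarith
        ultimately have "(2 * t + C' * t) * a + (2 * t + 2 * C' * t) * b + (2 * t + C' / t) * t\<^sup>2 + (2 * t + 2 * C' * t + C' / t) * t\<^sup>2
            \<le> (2 * t + C' * t) * a + (2 * t + 2 * C' * t) * b + 4 * t + 4 * (C' * t) + t"
          using tt t C' by (intro gen[of _ "t * t\<^sup>2" "C' * t" _ "C' * (t * t\<^sup>2)"]) auto
        also have "\<dots> = t * K"
          by (simp add: K_def algebra_simps)
        finally show "(2 * t + C' * t) * a + (2 * t + 2 * C' * t) * b + (2 * t + C' / t) * t\<^sup>2 + (2 * t + 2 * C' * t + C' / t) * t\<^sup>2 \<le> t * K" .
      qed
      finally show ?case .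
    qed
  qed
  have L1: "(\<lambda>n. \<integral>\<^sup>+ x. norm (B' n x (f' n x) \<bullet> g' n x - B x (f x) \<bullet> g x) \<partial>M) \<longlonglongrightarrow> 0"
  proof (rule tendsto_0_ennrealI)
    fix e :: real assume e: "e > 0"
    define t where "t = min 1 (e / (2 * K))"
    have t: "t > 0" "t \<le> 1" using e K by (auto simp: t_def)
    have "t * K \<le> e / (2 * K) * K"
      unfolding t_def using K by (intro mult_right_mono) auto
    then have "t * K < e" using K e by simp
    with est[OF t] show "eventually (\<lambda>n. (\<integral>\<^sup>+ x. norm (B' n x (f' n x) \<bullet> g' n x - B x (f x) \<bullet> g x) \<partial>M) < ennreal e) sequentially"
      using t K by (auto elim!: eventually_mono intro: le_less_trans simp: ennreal_lessI e)
  qed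
  obtain n where n: "(\<integral>\<^sup>+ x. norm (B' n x (f' n x) \<bullet> g' n x - B x (f x) \<bullet> g x) \<partial>M) < ennreal 1"
    using order_tendstoD(2)[OF L1, of "ennreal 1"] by (auto simp: eventually_sequentially)
  have "integrable M (\<lambda>x. B' n x (f' n x) \<bullet> g' n x - B x (f x) \<bullet> g x)"
    by (rule integrableI_bounded) (use n in \<open>auto intro: less_trans\<close>)
  from Bochner_Integration.integrable_diff[OF int[of n] this]
  show I: "integrable M (\<lambda>x. B x (f x) \<bullet> g x)" by simp
  show "(\<lambda>n. \<integral>x. B' n x (f' n x) \<bullet> g' n x \<partial>M) \<longlonglongrightarrow> (\<integral>x. B x (f x) \<bullet> g x \<partial>M)"
    by (rule tendsto_L1_int[OF int I L1])
qed

text \<open>Integration by parts from translation invariance instead of iterated integrals: each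
  difference quotient of \<open>h\<close> has integral 0. The mean value theorem bounds the
  quotients by C, and for steps of length at most 1 they live in the ball of radius R + norm e, so
  dominated convergence applies. Measurability of \<open>h'\<close> comes from its being their
  limit.\<close>

lemma integral_directional_derivative_eq_0:
  fixes h h' :: "'a::euclidean_space \<Rightarrow> real" and e :: 'a
  assumes deriv: "\<And>x. ((\<lambda>t. h (x + t *\<^sub>R e)) has_real_derivative h' x) (at 0)"
    and cont: "continuous_on UNIV h"
    and supp: "\<And>x. norm x > R \<Longrightarrow> h x = 0"
    and bound: "\<And>x. \<bar>h' x\<bar> \<le> C"
  shows "integral\<^sup>L lborel h' = 0"
proof -
  have [measurable]: "h \<in> borel_measurable borel"
    by (rule borel_measurable_continuous_onI[OF cont])
  have hI: "integrable lborel h"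
  proof -
    have "integrable lborel (\<lambda>x. indicator (cball 0 R) x *\<^sub>R h x)"
      by (rule borel_integrable_compact[OF compact_cball continuous_on_subset[OF cont subset_UNIV]])
    moreover have "(\<lambda>x. indicator (cball 0 R) x *\<^sub>R h x) = h"
      using supp by (auto simp: indicator_def fun_eq_iff not_le)
    ultimately show ?thesis by simp
  qed
  have C: "C \<ge> 0" using bound[of 0] by linarith
  define t where "t n = inverse (real (Suc n))" for n
  have t: "t n > 0" "t n \<le> 1" for n by (auto simp: t_def inverse_le_1_iff)
  define q where "q n x = (h (x + t n *\<^sub>R e) - h x) / t n" for n x
  have [measurable]: "q n \<in> borel_measurable borel" for n
    unfolding q_def[abs_def] by measurable
  have lim: "(\<lambda>n. q n x) \<longlonglongrightarrow> h' x" for x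
  proof -
    have "((\<lambda>t. (h (x + t *\<^sub>R e) - h x) / t) \<longlongrightarrow> h' x) (at 0)"
      using deriv[of x] by (simp add: has_field_derivative_iff)
    moreover have "filterlim t (at 0) sequentially"
      using t LIMSEQ_inverse_real_of_nat unfolding filterlim_at t_def[abs_def]
      by (auto intro!: always_eventually simp: t_def[abs_def] less_imp_neq[symmetric])
    ultimately show ?thesis
      unfolding q_def by (rule filterlim_compose)
  qed
  have bq: "\<bar>q n x\<bar> \<le> C" for n x
  proof -
    have "((\<lambda>s. h (x + s *\<^sub>R e)) has_real_derivative h' (x + s *\<^sub>R e)) (at s)" for s
      using deriv[of "x + s *\<^sub>R e"] DERIV_shift[of "\<lambda>s. h (x + s *\<^sub>R e)" "h' (x + s *\<^sub>R e)" 0 s]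
      by (simp add: algebra_simps)
    then obtain z where "h (x + t n *\<^sub>R e) - h (x + 0 *\<^sub>R e) = (t n - 0) * h' (x + z *\<^sub>R e)"
      using MVT2[of 0 "t n" "\<lambda>s. h (x + s *\<^sub>R e)" "\<lambda>s. h' (x + s *\<^sub>R e)"] t(1)[of n] by metis
    then show ?thesis
      using t(1)[of n] bound[of "x + z *\<^sub>R e"] by (simp add: q_def)
  qed
  have sq: "q n x = 0" if "norm x > R + norm e" for n x
  proof -
    have "norm (t n *\<^sub>R e) \<le> norm e"
      using t[of n] by (simp add: mult_left_le_one_le)
    then have "norm (x + t n *\<^sub>R e) > R"
      using that norm_triangle_ineq2[of x "- (t n *\<^sub>R e)"] by simp
    moreover have "norm x > R"
      using that norm_ge_zero[of e] by linarith
    ultimately show ?thesis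
      by (simp add: q_def supp)
  qed
  have "(\<lambda>n. integral\<^sup>L lborel (q n)) \<longlonglongrightarrow> integral\<^sup>L lborel h'"
  proof (rule integral_dominated_convergence[where w = "\<lambda>x::'a. C * indicator (cball 0 (R + norm e)) x"])
    show "h' \<in> borel_measurable lborel"
      using borel_measurable_LIMSEQ_metric[of q lborel h'] lim by simp
    show "AE x in lborel. norm (q n x) \<le> C * indicator (cball 0 (R + norm e)) x" for n
      using bq sq C by (auto simp: indicator_def not_le)
    show "integrable lborel (\<lambda>x::'a. C * indicator (cball 0 (R + norm e)) x)"
      using emeasure_bounded_finite[OF bounded_cball[of "0::'a" "R + norm e"]]
      by (intro integrable_mult_right) (simp add: integrable_indicator_iff)
  qed (use lim in auto)
  moreover have "integral\<^sup>L lborel (q n) = 0" for n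
  proof -
    have "integral\<^sup>L lborel (q n) = (\<integral>x. (h (x - (- t n *\<^sub>R e)) - h x) / t n \<partial>lborel)"
      by (simp add: q_def[abs_def])
    also have "\<dots> = ((\<integral>x. h (x - (- t n *\<^sub>R e)) \<partial>lborel) - integral\<^sup>L lborel h) / t n"
      using Bochner_Integration.integral_diff[OF integrable_lborel_translate[OF hI] hI, of "- t n *\<^sub>R e"]
      by simp
    also have "\<dots> = 0"
      using integral_lborel_translate[of h "- t n *\<^sub>R e"] by simp
    finally show ?thesis .
  qed
  ultimately show ?thesis
    by (simp add: LIMSEQ_const_iff)
qed

section \<open>Uniform error and differentiation of convolutions\<close>

lemma conv_alt:
  fixes f :: "'a::euclidean_space \<Rightarrow> 'b::euclidean_space"
  assumes [measurable]: "\<rho> \<in> borel_measurable borel" "f \<in> borel_measurable borel"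
  shows "conv \<rho> f x = (\<integral>y. \<rho> (x - y) *\<^sub>R f y \<partial>lborel)"
proof -
  have "lborel = density (distr lborel borel (\<lambda>y::'a. x + (-1) *\<^sub>R y)) (\<lambda>_. 1)"
    using lborel_affine[of "-1::real" x] by simp
  then have d: "distr lborel borel (\<lambda>y::'a. x - y) = lborel"
    by (simp add: density_1)
  have "(\<integral>y. \<rho> (x - y) *\<^sub>R f y \<partial>distr lborel borel (\<lambda>y::'a. x - y)) = (\<integral>y. \<rho> (x - (x - y)) *\<^sub>R f (x - y) \<partial>lborel)"
    by (rule integral_distr) measurable
  then show ?thesis
    unfolding d conv_def by simp
qed

text \<open>Only the behaviour of \<open>f\<close> near the point x is constrained, because it is
  applied to a map cut off outside a box, which may jump at the boundary.\<close>

lemma conv_sup_error: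
  fixes f :: "'a::euclidean_space \<Rightarrow> 'b::euclidean_space"
  assumes k: "kernel \<delta> \<rho>" and f: "integrable lborel f" and "e \<ge> 0"
    and "\<And>y. norm y < \<delta> \<Longrightarrow> norm (f (x - y) - f x) \<le> e"
  shows "norm (conv \<rho> f x - f x) \<le> e"
proof -
  have "norm (conv \<rho> f x - f x) \<le> (\<integral>y. \<rho> y * e \<partial>lborel)"
    unfolding conv_diff(1)[OF k f]
  proof (rule Bochner_Integration.integral_norm_bound_integral[OF conv_diff(2)[OF k f]])
    fix y
    show "norm (\<rho> y *\<^sub>R (f (x - y) - f x)) \<le> \<rho> y * e"
      using assms(4)[of y] kernelD(2,3)[OF k, of y]
      by (cases "norm y < \<delta>") (auto intro: mult_left_mono)
  qed (use kernelD(6)[OF k] in simp)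
  then show ?thesis using kernelD(4)[OF k] by simp
qed

text \<open>Differentiation under the integral puts the derivative on \<psi>, so \<open>u\<close>
  need only be continuous on the box. The conclusion has the shape of the hypothesis, which allows a
  second application with \<psi>' in place of \<psi>.\<close>

lemma conv_on_has_derivative:
  fixes \<psi> :: "real^'k \<Rightarrow> real" and u :: "real^'k \<Rightarrow> 'b::euclidean_space"
  assumes deriv: "\<And>z. (\<psi> has_derivative (\<lambda>h. \<Sum>i\<in>UNIV. h $ i * \<psi>' i z)) (at z)"
    and cont: "\<And>i. continuous_on UNIV (\<psi>' i)" and u: "continuous_on (cbox a b) u"
  shows "((\<lambda>x. integral (cbox a b) (\<lambda>y. \<psi> (x - y) *\<^sub>R u y)) has_derivative
    (\<lambda>h. \<Sum>i\<in>UNIV. h $ i *\<^sub>R integral (cbox a b) (\<lambda>y. \<psi>' i (x - y) *\<^sub>R u y))) (at x)"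
proof -
  define E :: "'k \<Rightarrow> (real^'k) \<Rightarrow>\<^sub>L real" where "E i = Blinfun (\<lambda>h. h $ i)" for i
  have E: "E i h = h $ i" for i h
    unfolding E_def by (simp add: bounded_linear_Blinfun_apply bounded_linear_vec_nth)
  \<comment> \<open>The derivative in x of the integrand, as a bounded linear map, so that its joint
    continuity can be expressed and it can itself be integrated over the box.\<close>
  define L where "L x t = (\<Sum>i\<in>UNIV. \<psi>' i (x - t) *\<^sub>R (blinfun_scaleR_left (u t) o\<^sub>L E i))" for x t
  have L: "L x t h = (\<Sum>i\<in>UNIV. h $ i * \<psi>' i (x - t)) *\<^sub>R u t" for x t h
    by (simp add: L_def blinfun.sum_left blinfun.scaleR_left E scaleR_sum_left algebra_simps)
  have \<psi>: "continuous_on UNIV \<psi>"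
    by (rule has_derivative_continuous_on[OF has_derivative_at_withinI[OF deriv]])
  have c: "continuous_on (UNIV \<times> cbox a b) (\<lambda>(x, t). f (x - t))" if "continuous_on UNIV f" for f :: "real^'k \<Rightarrow> real"
    unfolding split_beta by (intro continuous_on_compose2[OF that] continuous_intros) auto
  have usnd: "continuous_on (UNIV \<times> cbox a b) (\<lambda>(x::real^'k, t). u t)"
    unfolding split_beta by (intro continuous_on_compose2[OF u] continuous_intros) auto
  have int: "(\<lambda>y. f (x - y) *\<^sub>R u y) integrable_on cbox a b" if "continuous_on UNIV f" for f x
    by (intro integrable_continuous continuous_intros u continuous_on_compose2[OF that]) auto
  have Lc: "continuous_on (UNIV \<times> cbox a b) (\<lambda>(x, t). L x t)"
    unfolding L_def split_beta
    by (intro continuous_intros c[OF cont, unfolded split_beta]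
        bounded_linear.continuous_on[OF bounded_linear_blinfun_scaleR_left] usnd[unfolded split_beta])
  have "((\<lambda>x. integral (cbox a b) (\<lambda>y. \<psi> (x - y) *\<^sub>R u y)) has_derivative
      blinfun_apply (integral (cbox a b) (L x))) (at x within UNIV)"
  proof (rule leibniz_rule)
    fix x t assume "t \<in> cbox a b"
    have "((\<lambda>x. x - t) has_derivative (\<lambda>h. h)) (at x)"
      by (auto intro!: derivative_eq_intros)
    from has_derivative_scaleR_left[OF has_derivative_compose[OF this deriv], of "u t"]
    show "((\<lambda>x. \<psi> (x - t) *\<^sub>R u t) has_derivative blinfun_apply (L x t)) (at x within UNIV)"
      by (simp add: L[abs_def] fun_eq_iff)
  qed (use int[OF \<psi>] Lc in auto)
  moreover have "blinfun_apply (integral (cbox a b) (L x)) h =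
      (\<Sum>i\<in>UNIV. h $ i *\<^sub>R integral (cbox a b) (\<lambda>y. \<psi>' i (x - y) *\<^sub>R u y))" for h
  proof -
    have "continuous_on (cbox a b) (\<lambda>t. (\<lambda>(x, t). L x t) (x, t))"
      by (rule continuous_on_compose2[OF Lc]) (auto intro!: continuous_intros)
    then have "continuous_on (cbox a b) (L x)" by simp
    then have "blinfun_apply (integral (cbox a b) (L x)) h = integral (cbox a b) (\<lambda>t. L x t h)"
      using integral_linear[OF integrable_continuous blinfun.bounded_linear_left, of a b "L x" h] by (simp add: o_def)
    also have "\<dots> = integral (cbox a b) (\<lambda>t. \<Sum>i\<in>UNIV. h $ i *\<^sub>R (\<psi>' i (x - t) *\<^sub>R u t))"
      by (simp add: L scaleR_sum_left)
    also have "\<dots> = (\<Sum>i\<in>UNIV. integral (cbox a b) (\<lambda>t. h $ i *\<^sub>R (\<psi>' i (x - t) *\<^sub>R u t)))"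
      by (rule integral_sum) (auto intro!: integrable_cmul int[OF cont] simp del: scaleR_scaleR)
    finally show ?thesis by (simp del: scaleR_scaleR)
  qed
  then have "blinfun_apply (integral (cbox a b) (L x)) =
      (\<lambda>h. \<Sum>i\<in>UNIV. h $ i *\<^sub>R integral (cbox a b) (\<lambda>y. \<psi>' i (x - y) *\<^sub>R u y))"
    by (rule ext)
  ultimately show ?thesis by simp
qed

section \<open>The curl of a smooth pullback\<close>

lemma has_derivative_imp_directional:
  assumes "(h has_derivative D) (at x)"
  shows "((\<lambda>t. h (x + t *\<^sub>R e)) has_real_derivative D e) (at 0)"
proof -
  have "((\<lambda>t. x + t *\<^sub>R e) has_derivative (\<lambda>t. t *\<^sub>R e)) (at 0)"
    by (auto intro!: derivative_eq_intros)
  from has_derivative_compose[OF this, of h D] assms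
  have "((\<lambda>t. h (x + t *\<^sub>R e)) has_derivative (\<lambda>t. D (t *\<^sub>R e))) (at 0)"
    by simp
  moreover have "(\<lambda>t. D (t *\<^sub>R e)) = (*) (D e)"
    using linear_scale[OF has_derivative_linear[OF assms]] by (auto simp: fun_eq_iff)
  ultimately show ?thesis
    by (simp add: has_field_derivative_def)
qed

lemma sum_axis_mult [simp]: "(\<Sum>i\<in>UNIV. axis j 1 $ i * f i) = (f j :: real)"
  by (simp add: axis_def if_distrib[of "\<lambda>x. x * _"] cong: if_cong)

lemma sum_axis_scaleR [simp]: "(\<Sum>i\<in>UNIV. axis j 1 $ i *\<^sub>R f i) = (f j :: 'b::real_vector)"
  by (simp add: axis_def if_distrib[of "\<lambda>x. x *\<^sub>R _"] cong: if_cong)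

text \<open>\<open>d\<close> is the j-th partial derivative of \<phi> (\<omega>(U) \<bullet> W), so
  this is integration by parts. \<open>W\<close> is kept separate from \<open>U\<close> in order to
  be taken as a partial derivative of it.\<close>

lemma integral_partial_derivative_eq_0:
  fixes U :: "real^'k \<Rightarrow> 'b::euclidean_space" and \<phi> :: "real^'k \<Rightarrow> real"
  assumes U: "\<And>z. (U has_derivative (\<lambda>h. \<Sum>i\<in>UNIV. h $ i *\<^sub>R U' i z)) (at z)"
    and W: "\<And>z. (W has_derivative (\<lambda>h. \<Sum>i\<in>UNIV. h $ i *\<^sub>R W' i z)) (at z)"
    and W'_cont: "continuous_on UNIV (W' j)" and U'_cont: "continuous_on UNIV (U' j)"
    and \<phi>: "\<And>z. (\<phi> has_derivative (\<lambda>h. \<Sum>i\<in>UNIV. h $ i * \<phi>' i z)) (at z)"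
    and \<phi>'_cont: "continuous_on UNIV (\<phi>' j)"
    and K: "compact K" "\<And>z. z \<notin> K \<Longrightarrow> \<phi> z = 0"
    and \<omega>: "C1_with \<Omega> \<omega> D\<omega>" "open \<Omega>" "U ` K \<subseteq> \<Omega>"
  defines "d \<equiv> \<lambda>z. \<phi> z * (D\<omega> (U z) (U' j z) \<bullet> W z + \<omega> (U z) \<bullet> W' j z) + \<phi>' j z * (\<omega> (U z) \<bullet> W z)"
  shows "integrable lborel (\<lambda>z. indicator K z * d z)" "(\<integral>z. indicator K z * d z \<partial>lborel) = 0"
proof -
  have \<omega>_deriv: "(\<omega> has_derivative blinfun_apply (D\<omega> y)) (at y)" if "y \<in> \<Omega>" for y
    using \<omega>(1) that by (simp add: C1_with_def)
  have contU: "continuous_on UNIV U" and contW: "continuous_on UNIV W" and cont\<phi>: "continuous_on UNIV \<phi>"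
    by (rule has_derivative_continuous_on[OF has_derivative_at_withinI[OF U]]
        has_derivative_continuous_on[OF has_derivative_at_withinI[OF W]]
        has_derivative_continuous_on[OF has_derivative_at_withinI[OF \<phi>]])+
  have \<omega>_cont: "continuous_on \<Omega> \<omega>"
    by (rule has_derivative_continuous_on[OF has_derivative_at_withinI[OF \<omega>_deriv]])
  have D\<omega>_cont: "continuous_on \<Omega> D\<omega>"
    using \<omega>(1) by (simp add: C1_with_def)
  have cK: "continuous_on K U" "continuous_on K W" "continuous_on K \<phi>" "continuous_on K (W' j)" "continuous_on K (U' j)" "continuous_on K (\<phi>' j)"
    by (rule continuous_on_subset[OF contU] continuous_on_subset[OF contW] continuous_on_subset[OF cont\<phi>]
        continuous_on_subset[OF W'_cont] continuous_on_subset[OF U'_cont] continuous_on_subset[OF \<phi>'_cont] subset_UNIV)+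
  have dK: "continuous_on K d"
    unfolding d_def
    by (intro continuous_on_add continuous_on_mult continuous_on_inner blinfun.continuous_on cK
        continuous_on_compose2[OF D\<omega>_cont cK(1) \<omega>(3)] continuous_on_compose2[OF \<omega>_cont cK(1) \<omega>(3)])
  from borel_integrable_compact[OF K(1) dK]
  show "integrable lborel (\<lambda>z. indicator K z * d z)"
    by simp
  define h where "h z = \<phi> z * (\<omega> (U z) \<bullet> W z)" for z
  \<comment> \<open>Off K the point \<open>U z\<close> may leave \<Omega>, where nothing is known
    about \<omega>. There \<phi> is 0, hence so is h, on an open set, and the derivative is
    0.\<close>
  define Dh where "Dh z v = (if z \<in> K then \<phi> z * (\<omega> (U z) \<bullet> (\<Sum>i\<in>UNIV. v $ i *\<^sub>R W' i z) + D\<omega> (U z) (\<Sum>i\<in>UNIV. v $ i *\<^sub>R U' i z) \<bullet> W z)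
      + (\<Sum>i\<in>UNIV. v $ i * \<phi>' i z) * (\<omega> (U z) \<bullet> W z) else 0)" for z v
  have h: "(h has_derivative Dh z) (at z)" for z
  proof (cases "z \<in> K")
    case True
    have "U z \<in> \<Omega>" using True \<omega>(3) by auto
    from has_derivative_compose[OF U \<omega>_deriv[OF this]]
    have "((\<lambda>z. \<omega> (U z)) has_derivative (\<lambda>v. D\<omega> (U z) (\<Sum>i\<in>UNIV. v $ i *\<^sub>R U' i z))) (at z)" .
    from has_derivative_mult[OF \<phi> has_derivative_inner[OF this W]]
    show ?thesis
      using True by (simp add: h_def[abs_def] Dh_def[abs_def])
  next
    case False
    have "(h has_derivative (\<lambda>_. 0)) (at z)"
    proof (rule has_derivative_transform_within_open[of "\<lambda>_. 0" _ _ _ "- K"])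
      show "open (- K)" using K(1) by (simp add: compact_imp_closed open_Compl)
    qed (use False K(2) in \<open>auto simp: h_def\<close>)
    then show ?thesis
      using False by (simp add: Dh_def[abs_def])
  qed
  obtain R where R: "\<And>z. z \<in> K \<Longrightarrow> norm z \<le> R"
    using compact_imp_bounded[OF K(1)] by (auto simp: bounded_iff)
  obtain C where C: "\<And>z. z \<in> K \<Longrightarrow> \<bar>d z\<bar> \<le> C"
    using compact_imp_bounded[OF compact_continuous_image[OF dK K(1)]] by (auto simp: bounded_iff)
  show "(\<integral>z. indicator K z * d z \<partial>lborel) = 0"
  proof (rule integral_directional_derivative_eq_0)
    fix z
    have "Dh z (axis j 1) = indicator K z * d z"
      by (simp add: Dh_def d_def add.commute)
    then show "((\<lambda>t. h (z + t *\<^sub>R axis j 1)) has_real_derivative indicator K z * d z) (at 0)"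
      using has_derivative_imp_directional[OF h, of z "axis j 1"] by simp
    show "\<bar>indicator K z * d z\<bar> \<le> max C 0"
      using C[of z] by (auto simp: indicator_def)
    show "h z = 0" if "norm z > R"
      using R[of z] K(2)[of z] that by (force simp: h_def)
  next
    show "continuous_on UNIV h"
      by (rule has_derivative_continuous_on[OF has_derivative_at_withinI[OF h]])
  qed
qed

text \<open>The exterior derivative of the pulled back form, tested against \<phi>. The previous
  lemma with \<open>W = U' i\<close> in direction j, minus the same with i and j exchanged, loses
  the terms \<omega>(U) \<bullet> U'' by symmetry.\<close>

lemma smooth_curl_identity:
  fixes U :: "real^'k \<Rightarrow> 'b::euclidean_space" and \<phi> :: "real^'k \<Rightarrow> real"
  assumes U: "\<And>z. (U has_derivative (\<lambda>h. \<Sum>i\<in>UNIV. h $ i *\<^sub>R U' i z)) (at z)"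
    and U': "\<And>i z. (U' i has_derivative (\<lambda>h. \<Sum>j\<in>UNIV. h $ j *\<^sub>R U'' i j z)) (at z)"
    and U'': "\<And>i j. continuous_on UNIV (U'' i j)" "\<And>i j. U'' i j = U'' j i"
    and \<phi>: "\<And>z. (\<phi> has_derivative (\<lambda>h. \<Sum>i\<in>UNIV. h $ i * \<phi>' i z)) (at z)"
    and \<phi>'_cont: "\<And>i. continuous_on UNIV (\<phi>' i)"
    and K: "compact K" "\<And>z. z \<notin> K \<Longrightarrow> \<phi> z = 0"
    and \<omega>: "C1_with \<Omega> \<omega> D\<omega>" "open \<Omega>" "U ` K \<subseteq> \<Omega>"
  shows "(\<integral>z. indicator K z * (\<phi> z * (D\<omega> (U z) (U' j z) \<bullet> U' i z) - \<phi> z * (D\<omega> (U z) (U' i z) \<bullet> U' j z)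
      + \<phi>' j z * (\<omega> (U z) \<bullet> U' i z) - \<phi>' i z * (\<omega> (U z) \<bullet> U' j z)) \<partial>lborel) = 0"
proof -
  have c: "continuous_on UNIV (U' i)" for i
    by (rule has_derivative_continuous_on[OF has_derivative_at_withinI[OF U']])
  note * = integral_partial_derivative_eq_0[OF U U' U''(1) c \<phi> \<phi>'_cont K \<omega>]
  define d where "d i j z = indicator K z * (\<phi> z * (D\<omega> (U z) (U' i z) \<bullet> U' j z + \<omega> (U z) \<bullet> U'' j i z) + \<phi>' i z * (\<omega> (U z) \<bullet> U' j z))" for i j z
  have d1: "integrable lborel (d i j)" for i j
    unfolding d_def[abs_def] by (rule *(1))
  have d2: "integral\<^sup>L lborel (d i j) = 0" for i j
    unfolding d_def[abs_def] by (rule *(2))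
  have "indicator K z * (\<phi> z * (D\<omega> (U z) (U' j z) \<bullet> U' i z) - \<phi> z * (D\<omega> (U z) (U' i z) \<bullet> U' j z)
      + \<phi>' j z * (\<omega> (U z) \<bullet> U' i z) - \<phi>' i z * (\<omega> (U z) \<bullet> U' j z)) = d j i z - d i j z" for z
    unfolding d_def U''(2)[of i j] by (simp add: algebra_simps)
  then show ?thesis
    using Bochner_Integration.integral_diff[OF d1[of j i] d1[of i j]] d2 by simp
qed

lemma borel_measurable_blinfun_apply:
  fixes T :: "'a \<Rightarrow> ('b::euclidean_space \<Rightarrow>\<^sub>L 'c::euclidean_space)"
  assumes T: "\<And>v. (\<lambda>z. T z v) \<in> borel_measurable M" and [measurable]: "f \<in> borel_measurable M"
  shows "(\<lambda>z. T z (f z)) \<in> borel_measurable M"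
proof -
  have "T z (f z) = (\<Sum>b\<in>Basis. (f z \<bullet> b) *\<^sub>R T z b)" for z
    by (subst (1) euclidean_representation[of "f z", symmetric])
      (simp add: blinfun.sum_right blinfun.scaleR_right)
  moreover note [measurable] = T
  ultimately show ?thesis by simp
qed

section \<open>The curl of a Sobolev pullback\<close>

lemma mollifier_kernel:
  assumes "mollifier \<delta> \<rho> \<rho>' \<rho>''"
  shows "kernel \<delta> \<rho>"
proof -
  have "continuous_on UNIV \<rho>"
    using assms by (auto simp: mollifier_def dest: spec[of _ 0])
  then show ?thesis
    using assms by (simp add: mollifier_def kernel_def)
qed

lemma integral_cbox_eq_lborel:
  fixes g :: "'a::euclidean_space \<Rightarrow> 'b::euclidean_space"
  assumes "continuous_on (cbox a b) g"
  shows "integral (cbox a b) g = (\<integral>y. indicator (cbox a b) y *\<^sub>R g y \<partial>lborel)"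
proof -
  have "set_integrable lborel (cbox a b) g"
    unfolding set_integrable_def using borel_integrable_compact[OF compact_cbox assms] .
  from set_borel_integral_eq_integral(2)[OF this] show ?thesis
    by (simp add: set_lebesgue_integral_def)
qed

lemma conv_on_continuous:
  fixes u :: "'a::euclidean_space \<Rightarrow> 'b::euclidean_space"
  assumes "continuous_on UNIV \<psi>" "continuous_on (cbox a b) u"
  shows "continuous_on UNIV (\<lambda>x. integral (cbox a b) (\<lambda>y. \<psi> (x - y) *\<^sub>R u y))"
proof (rule integral_continuous_on_param)
  show "continuous_on (UNIV \<times> cbox a b) (\<lambda>(x, y). \<psi> (x - y) *\<^sub>R u y)"
    unfolding split_beta
    by (intro continuous_on_scaleR continuous_on_compose2[OF assms(1)] continuous_on_compose2[OF assms(2)] continuous_intros) auto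
qed

text \<open>Links the two forms of a mollification: the integral over the box, which is
  differentiated, and the convolution over the whole space, to which the error estimates
  apply.\<close>

lemma conv_on_eq_conv:
  fixes u :: "'a::euclidean_space \<Rightarrow> 'b::euclidean_space"
  assumes "continuous_on UNIV \<psi>" "continuous_on (cbox a b) u"
  shows "integral (cbox a b) (\<lambda>y. \<psi> (x - y) *\<^sub>R u y) = conv \<psi> (\<lambda>y. indicator (cbox a b) y *\<^sub>R u y) x"
proof -
  have "continuous_on (cbox a b) (\<lambda>y. \<psi> (x - y) *\<^sub>R u y)"
    by (intro continuous_on_scaleR assms continuous_on_compose2[OF assms(1)] continuous_intros) auto
  moreover have "\<psi> \<in> borel_measurable borel"
    by (rule borel_measurable_continuous_onI[OF assms(1)])
  moreover have "(\<lambda>y. indicator (cbox a b) y *\<^sub>R u y) \<in> borel_measurable borel"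
    by (rule borel_measurable_continuous_on_indicator[OF _ assms(2)]) simp
  ultimately show ?thesis
    by (simp add: integral_cbox_eq_lborel conv_alt mult.commute)
qed

text \<open>\<open>G i\<close> is a Borel representative of the weak partial derivative, cut off outside the box; weak
  differentiability is only required against translated mollifiers.\<close>

locale sobolev_box =
  fixes a b :: "real^'k" and u :: "real^'k \<Rightarrow> 'b::euclidean_space" and G :: "'k \<Rightarrow> real^'k \<Rightarrow> 'b"
  assumes u_cont: "continuous_on (cbox a b) u"
    and G_meas[measurable]: "\<And>i. G i \<in> borel_measurable borel"
    and G_supp: "\<And>i z. z \<notin> cbox a b \<Longrightarrow> G i z = 0"
    and G_L2: "\<And>i. (\<integral>\<^sup>+ z. ennreal ((norm (G i z))\<^sup>2) \<partial>lborel) < \<infinity>"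
    and weak: "\<And>\<delta> \<rho> \<rho>' \<rho>'' x i. mollifier \<delta> \<rho> \<rho>' \<rho>'' \<Longrightarrow> \<delta> > 0 \<Longrightarrow> cball x \<delta> \<subseteq> cbox a b \<Longrightarrow>
      integral (cbox a b) (\<lambda>y. \<rho>' i (x - y) *\<^sub>R u y) = conv \<rho> (G i) x"
begin

lemma G_square_integrable: "integrable lborel (\<lambda>z. (norm (G i z))\<^sup>2)"
  using G_L2[of i] by (intro integrableI_nonneg) auto

lemma G_norm_integrable: "integrable lborel (\<lambda>z. norm (G i z) *\<^sub>R G i z)"
  using G_square_integrable[of i]
  by (rule Bochner_Integration.integrable_bound) (auto simp: power2_eq_square)

lemma G_integrable: "integrable lborel (G i)"
proof (rule Bochner_Integration.integrable_bound)
  have "integrable lborel (indicator (cbox a b) :: _ \<Rightarrow> real)"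
    using emeasure_bounded_finite[OF bounded_cbox[of a b]] by (simp add: integrable_indicator_iff)
  with G_square_integrable[of i]
  show "integrable lborel (\<lambda>z. (norm (G i z))\<^sup>2 + indicator (cbox a b) z)"
    by (rule Bochner_Integration.integrable_add)
  have "norm (G i z) \<le> (norm (G i z))\<^sup>2 + indicator (cbox a b) z" for z
  proof (cases "z \<in> cbox a b")
    case True
    have "0 \<le> (norm (G i z) - 1 / 2)\<^sup>2" by simp
    then show ?thesis using True by (simp add: power2_eq_square algebra_simps)
  qed (simp add: G_supp)
  then show "AE z in lborel. norm (G i z) \<le> norm ((norm (G i z))\<^sup>2 + indicator (cbox a b) z :: real)"
    by simp
qed measurable

text \<open>The limit of \<open>smooth_curl_identity\<close> along mollifications of
  \<open>u\<close>. The terms with \<phi>' vanish in the limit because \<omega>(u) is orthogonal to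
  the weak derivatives. The margin \<eta> between K and the box accommodates the mollification
  radius.\<close>

lemma weak_curl_identity:
  assumes K: "K = cball x0 s" "s > 0" "\<eta> > 0" "cball x0 (s + \<eta>) \<subseteq> cbox a b"
    and \<phi>: "\<And>z. (\<phi> has_derivative (\<lambda>h. \<Sum>i\<in>UNIV. h $ i * \<phi>' i z)) (at z)"
    and \<phi>'_cont: "\<And>i. continuous_on UNIV (\<phi>' i)" and \<phi>_0: "\<And>z. z \<notin> K \<Longrightarrow> \<phi> z = 0"
    and \<omega>: "C1_with \<Omega> \<omega> D\<omega>" "open \<Omega>" "u ` cbox a b \<subseteq> \<Omega>"
    and orth: "AE z in lborel. z \<in> cbox a b \<longrightarrow> (\<forall>i. \<omega> (u z) \<bullet> G i z = 0)"
  shows "(\<integral>z. indicator K z * (\<phi> z * (D\<omega> (u z) (G j z) \<bullet> G i z - D\<omega> (u z) (G i z) \<bullet> G j z)) \<partial>lborel) = 0"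
proof -
  let ?D = "cbox a b"
  have KD: "K \<subseteq> ?D" using K by auto
  have cK: "compact K" using K by simp
  have Ks[measurable]: "K \<in> sets borel" using K by simp
  have \<omega>_deriv: "(\<omega> has_derivative blinfun_apply (D\<omega> y)) (at y)" if "y \<in> \<Omega>" for y
    using \<omega>(1) that by (simp add: C1_with_def)
  have \<omega>_cont: "continuous_on \<Omega> \<omega>"
    by (rule has_derivative_continuous_on[OF has_derivative_at_withinI[OF \<omega>_deriv]])
  have D\<omega>_cont: "continuous_on \<Omega> D\<omega>"
    using \<omega>(1) by (simp add: C1_with_def)
  have \<phi>_cont: "continuous_on UNIV \<phi>"
    by (rule has_derivative_continuous_on[OF has_derivative_at_withinI[OF \<phi>]])
  have uK: "continuous_on K u" "u ` K \<subseteq> \<Omega>"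
    using continuous_on_subset[OF u_cont KD] \<omega>(3) KD by auto
  obtain e0 where e0: "e0 > 0" "(\<Union>y\<in>u ` K. cball y e0) \<subseteq> \<Omega>"
    using compact_subset_open_imp_cball_epsilon_subset[OF compact_continuous_image[OF uK(1) cK] \<omega>(2) uK(2)] .
  \<comment> \<open>A compact neighbourhood of u(K) inside \<Omega>. It will contain all values of
    the mollified maps on K, and \<omega> and D\<omega> are uniformly continuous on it.\<close>
  define N where "N = {x + y |x y. x \<in> u ` K \<and> y \<in> cball 0 e0}"
  have cN: "compact N"
    unfolding N_def by (intro compact_sums compact_continuous_image uK cK compact_cball)
  have N\<Omega>: "N \<subseteq> \<Omega>"
    using e0(2) unfolding N_def by (force simp: dist_norm)
  have inN: "w \<in> N" if "z \<in> K" "norm (w - u z) \<le> e0" for w z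
    unfolding N_def using that by (intro CollectI exI[of _ "u z"] exI[of _ "w - u z"]) auto
  have ucont: "\<exists>d>0. \<forall>x\<in>?D. \<forall>y\<in>?D. dist y x < d \<longrightarrow> dist (u y) (u x) < e" if "e > 0" for e
    using compact_uniformly_continuous[OF u_cont compact_cbox] that unfolding uniformly_continuous_on_def by blast
  obtain \<delta>0 where \<delta>0: "\<delta>0 > 0" "\<And>x y. x \<in> ?D \<Longrightarrow> y \<in> ?D \<Longrightarrow> dist y x < \<delta>0 \<Longrightarrow> dist (u y) (u x) < e0"
    using ucont[OF e0(1)] by blast
  \<comment> \<open>Radii at most \<eta> keep the supports inside the box, radii at most \<delta>0
    keep the mollified maps in \<open>N\<close>, and the last factor sends the radii to 0.\<close>
  define dl where "dl n = min \<eta> \<delta>0 * inverse (real (Suc n))" for n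
  have dl: "dl n > 0" "dl n \<le> \<eta>" "dl n \<le> \<delta>0" for n
  proof -
    have "min \<eta> \<delta>0 * inverse (real (Suc n)) \<le> min \<eta> \<delta>0 * 1"
      using K(3) \<delta>0(1) by (intro mult_left_mono) (auto simp: inverse_le_1_iff)
    then show "dl n > 0" "dl n \<le> \<eta>" "dl n \<le> \<delta>0"
      using K(3) \<delta>0(1) by (auto simp: dl_def)
  qed
  have "(\<lambda>n. min \<eta> \<delta>0 * inverse (real (Suc n))) \<longlonglongrightarrow> min \<eta> \<delta>0 * 0"
    by (intro tendsto_mult tendsto_const LIMSEQ_inverse_real_of_nat)
  then have dl_lim: "dl \<longlonglongrightarrow> 0" by (simp add: dl_def[abs_def])
  have "\<exists>\<rho> \<rho>' \<rho>''. mollifier (dl n) (\<rho> :: real^'k \<Rightarrow> real) \<rho>' \<rho>''" for n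
    using mollifier_exists[OF dl(1)[of n]] by metis
  then obtain \<rho> \<rho>' \<rho>'' where m: "\<And>n. mollifier (dl n) (\<rho> n :: real^'k \<Rightarrow> real) (\<rho>' n) (\<rho>'' n)"
    by metis
  note k = mollifier_kernel[OF m]
  have \<rho>: "(\<rho> n has_derivative (\<lambda>h. \<Sum>i\<in>UNIV. h $ i * \<rho>' n i z)) (at z)"
    "(\<rho>' n i has_derivative (\<lambda>h. \<Sum>j\<in>UNIV. h $ j * \<rho>'' n i j z)) (at z)"
    "continuous_on UNIV (\<rho>'' n i j)" "\<rho>'' n i j = \<rho>'' n j i" for n i j z
    using m[of n] unfolding mollifier_def by blast+
  have \<rho>'_cont: "continuous_on UNIV (\<rho>' n i)" for n i
    by (rule has_derivative_continuous_on[OF has_derivative_at_withinI[OF \<rho>(2)]])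
  define U where "U n x = integral ?D (\<lambda>y. \<rho> n (x - y) *\<^sub>R u y)" for n x
  define U' where "U' n i x = integral ?D (\<lambda>y. \<rho>' n i (x - y) *\<^sub>R u y)" for n i x
  define U'' where "U'' n i j x = integral ?D (\<lambda>y. \<rho>'' n i j (x - y) *\<^sub>R u y)" for n i j x
  have U: "(U n has_derivative (\<lambda>h. \<Sum>i\<in>UNIV. h $ i *\<^sub>R U' n i z)) (at z)" for n z
    unfolding U_def[abs_def] U'_def by (rule conv_on_has_derivative[OF \<rho>(1) \<rho>'_cont u_cont])
  have U': "(U' n i has_derivative (\<lambda>h. \<Sum>j\<in>UNIV. h $ j *\<^sub>R U'' n i j z)) (at z)" for n i z
    unfolding U'_def[abs_def] U''_def by (rule conv_on_has_derivative[OF \<rho>(2) \<rho>(3) u_cont])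
  have U'': "continuous_on UNIV (U'' n i j)" "U'' n i j = U'' n j i" for n i j
    unfolding U''_def[abs_def] \<rho>(4)[of n i j] by (rule conv_on_continuous[OF \<rho>(3) u_cont] refl)+
  have Ucont: "continuous_on S (U n)" "continuous_on S (U' n i)" for n i S
    by (rule continuous_on_subset[OF has_derivative_continuous_on[OF has_derivative_at_withinI[OF U]] subset_UNIV]
       continuous_on_subset[OF has_derivative_continuous_on[OF has_derivative_at_withinI[OF U']] subset_UNIV])+
  have Uerr: "norm (U n x - u x) \<le> e"
    if "x \<in> K" "e > 0" "d \<ge> dl n" "\<And>x y. x \<in> ?D \<Longrightarrow> y \<in> ?D \<Longrightarrow> dist y x < d \<Longrightarrow> dist (u y) (u x) < e" for n x e d
  proof -
    have i: "integrable lborel (\<lambda>y. indicator ?D y *\<^sub>R u y)"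
      by (rule borel_integrable_compact[OF compact_cbox u_cont])
    have "norm (conv (\<rho> n) (\<lambda>y. indicator ?D y *\<^sub>R u y) x - indicator ?D x *\<^sub>R u x) \<le> e"
    proof (rule conv_sup_error[OF k i])
      fix y :: "real^'k" assume y: "norm y < dl n"
      have "dist x0 (x - y) \<le> dist x0 x + norm y"
        using norm_triangle_ineq[of "x0 - x" y] by (simp add: dist_norm algebra_simps)
      then have "x - y \<in> ?D"
        using that(1) y dl(2)[of n] K(1,4) by (auto simp: subset_iff)
      moreover have "x \<in> ?D" using that(1) KD by auto
      moreover have "dist (x - y) x < d"
        using y that(3) by (simp add: dist_norm)
      ultimately show "norm (indicator ?D (x - y) *\<^sub>R u (x - y) - indicator ?D x *\<^sub>R u x) \<le> e"
        using that(4)[of x "x - y"] by (simp add: dist_norm)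
    qed (use that(2) in simp)
    then show ?thesis
      using that(1) KD conv_on_eq_conv[OF kernelD(1)[OF k] u_cont, of n x] by (auto simp: U_def)
  qed
  have UN: "U n x \<in> N" if "x \<in> K" for n x
    using inN[OF that Uerr[OF that e0(1) dl(3) \<delta>0(2)]] .
  have ulim: "uniform_limit K U u sequentially"
  proof (rule uniform_limitI)
    fix e :: real assume e: "e > 0"
    obtain d where d: "d > 0" "\<forall>x\<in>?D. \<forall>y\<in>?D. dist y x < d \<longrightarrow> dist (u y) (u x) < e / 2"
      using ucont[of "e / 2"] e by auto
    have "eventually (\<lambda>n. dl n < d) sequentially"
      using order_tendstoD(2)[OF dl_lim d(1)] .
    then show "eventually (\<lambda>n. \<forall>x\<in>K. dist (U n x) (u x) < e) sequentially"
    proof eventually_elim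
      case (elim n)
      have "dist (U n x) (u x) \<le> e / 2" if "x \<in> K" for x
        using Uerr[OF that _ less_imp_le[OF elim], of "e / 2"] d(2) e by (simp add: dist_norm)
      then show ?case using e by fastforce
    qed
  qed
  \<comment> \<open>On K as the whole space, the local convergences have the form that
    \<open>L2_blinfun_limit\<close> expects.\<close>
  let ?M = "restrict_space lborel K"
  have [simp]: "space ?M = K" by (simp add: space_restrict_space)
  have Mmeas: "f \<in> borel_measurable ?M" if "f \<in> borel_measurable borel" for f :: "real^'k \<Rightarrow> 'z::topological_space"
    using that by (simp add: measurable_restrict_space1)
  have Mcont: "f \<in> borel_measurable ?M" if "continuous_on K f" for f :: "real^'k \<Rightarrow> 'z::topological_space"
    using borel_measurable_continuous_on_restrict[OF that] by (simp cong: measurable_cong_sets sets_restrict_space_cong)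
  have Mint: "integrable ?M f" if "continuous_on K f" for f :: "real^'k \<Rightarrow> real"
    using borel_integrable_compact[OF cK that] by (simp add: integrable_restrict_space)
  have Mle: "(\<integral>\<^sup>+ x. f x \<partial>?M) \<le> (\<integral>\<^sup>+ x. f x \<partial>lborel)" for f
    by (subst nn_integral_restrict_space) (auto intro!: nn_integral_mono simp: indicator_def)
  have Glim: "(\<lambda>n. \<integral>\<^sup>+ x. ennreal ((norm (U' n i x - G i x))\<^sup>2) \<partial>?M) \<longlonglongrightarrow> 0" for i
  proof (rule tendsto_0_ennrealI)
    fix e :: real assume e: "e > 0"
    obtain d where d: "d > 0" "\<And>y. norm y < d \<Longrightarrow> shift_dist (\<lambda>x. norm (G i x) *\<^sub>R G i x) y \<le> ennreal (e / 4)"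
      using shift_dist_small[OF G_norm_integrable[of i], of "e / 4"] e by auto
    have "eventually (\<lambda>n. dl n < d) sequentially"
      using order_tendstoD(2)[OF dl_lim d(1)] .
    then show "eventually (\<lambda>n. (\<integral>\<^sup>+ x. ennreal ((norm (U' n i x - G i x))\<^sup>2) \<partial>?M) < ennreal e) sequentially"
    proof eventually_elim
      case (elim n)
      \<comment> \<open>The derivative sits on the kernel; the \<open>weak\<close> clause moves it
        to \<open>u\<close>, so on K the gradient of the mollified map is the mollified weak
        gradient. This needs the ball of radius \<open>dl n\<close> about x to lie in the
        box.\<close>
      have "U' n i x = conv (\<rho> n) (G i) x" if "x \<in> K" for x
      proof -
        have "cball x (dl n) \<subseteq> cball x0 (s + \<eta>)"
        proof
          fix w assume "w \<in> cball x (dl n)"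
          then show "w \<in> cball x0 (s + \<eta>)"
            using that dl(2)[of n] dist_triangle[of x0 w x] unfolding K(1) by simp
        qed
        then show ?thesis
          unfolding U'_def using weak[OF m dl(1)] K(4) by auto
      qed
      then have "(\<integral>\<^sup>+ x. ennreal ((norm (U' n i x - G i x))\<^sup>2) \<partial>?M) = (\<integral>\<^sup>+ x. ennreal ((norm (conv (\<rho> n) (G i) x - G i x))\<^sup>2) \<partial>?M)"
        by (intro nn_integral_cong) simp
      also have "\<dots> \<le> (\<integral>\<^sup>+ x. ennreal ((norm (conv (\<rho> n) (G i) x - G i x))\<^sup>2) \<partial>lborel)"
        by (rule Mle)
      also have "\<dots> \<le> 2 * ennreal (e / 4)"
        by (rule conv_L2_error[OF k G_integrable d(2)]) (use elim in simp)
      also have "\<dots> = ennreal (e / 2)"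
        using e by (simp flip: ennreal_numeral ennreal_mult)
      also have "\<dots> < ennreal e"
        using e by (simp add: ennreal_less_iff)
      finally show ?case .
    qed
  qed
  have GfinM: "(\<integral>\<^sup>+ x. ennreal ((norm (G i x))\<^sup>2) \<partial>?M) < \<infinity>" for i
    using Mle[of "\<lambda>x. ennreal ((norm (G i x))\<^sup>2)"] G_L2[of i] by (rule le_less_trans)
  have constM: "(\<integral>\<^sup>+ x. ennreal ((norm (1::real))\<^sup>2) \<partial>?M) < \<infinity>"
    using emeasure_compact_finite[OF cK] by (simp add: emeasure_restrict_space)
  have bnd: "bounded (f ` K)" if "continuous_on K f" for f :: "real^'k \<Rightarrow> 'z::metric_space"
    using compact_imp_bounded[OF compact_continuous_image[OF that cK]] .
  have compl: "uniform_limit K (\<lambda>n z. f (U n z)) (\<lambda>z. f (u z)) sequentially" if "continuous_on \<Omega> f"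
    for f :: "'b \<Rightarrow> 'z::metric_space"
    by (rule uniform_limit_compose_uniformly_continuous_on[OF ulim, of N])
      (use UN cN in \<open>auto intro: compact_uniformly_continuous continuous_on_subset[OF that N\<Omega>] compact_imp_closed\<close>)
  have cU: "continuous_on K (\<lambda>z. f (U n z))" if "continuous_on \<Omega> f" for f :: "'b \<Rightarrow> 'z::topological_space" and n
    by (rule continuous_on_compose2[OF that Ucont(1)]) (use UN N\<Omega> in auto)
  have cu: "continuous_on K (\<lambda>z. f (u z))" if "continuous_on \<Omega> f" for f :: "'b \<Rightarrow> 'z::topological_space"
    by (rule continuous_on_compose2[OF that uK])
  have \<phi>K: "continuous_on K \<phi>" "continuous_on K (\<phi>' i)" for i
    by (rule continuous_on_subset[OF \<phi>_cont subset_UNIV] continuous_on_subset[OF \<phi>'_cont subset_UNIV])+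
  define A where "A n i j = (\<integral>z. (\<phi> z *\<^sub>R D\<omega> (U n z)) (U' n j z) \<bullet> U' n i z \<partial>?M)" for n i j
  define A0 where "A0 i j = (\<integral>z. (\<phi> z *\<^sub>R D\<omega> (u z)) (G j z) \<bullet> G i z \<partial>?M)" for i j
  \<comment> \<open>The terms linear in the gradient are written as quadratic ones: the operator is
    the linear form given by \<omega>(U) and the second factor is the constant 1. The same limit
    lemma then covers both kinds.\<close>
  define B where "B n i j = (\<integral>z. (\<phi>' j z *\<^sub>R blinfun_inner_right (\<omega> (U n z))) (U' n i z) \<bullet> 1 \<partial>?M)" for n i j
  have Aint: "integrable ?M (\<lambda>z. (\<phi> z *\<^sub>R D\<omega> (U n z)) (U' n j z) \<bullet> U' n i z)" for n i j
    by (intro Mint continuous_on_inner blinfun.continuous_on continuous_on_scaleR \<phi>K cU[OF D\<omega>_cont] Ucont)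
  have Bint: "integrable ?M (\<lambda>z. (\<phi>' j z *\<^sub>R blinfun_inner_right (\<omega> (U n z))) (U' n i z) \<bullet> 1)" for n i j
    by (intro Mint continuous_on_inner blinfun.continuous_on continuous_on_scaleR \<phi>K
        bounded_linear.continuous_on[OF bounded_linear_blinfun_inner_right] cU[OF \<omega>_cont] Ucont continuous_on_const)
  have A: "integrable ?M (\<lambda>z. (\<phi> z *\<^sub>R D\<omega> (u z)) (G j z) \<bullet> G i z)" "(\<lambda>n. A n i j) \<longlonglongrightarrow> A0 i j" for i j
  proof -
    have c: "continuous_on K (\<lambda>z. \<phi> z *\<^sub>R D\<omega> (u z))"
      by (intro continuous_on_scaleR \<phi>K cu[OF D\<omega>_cont])
    obtain C where C: "\<And>z. z \<in> K \<Longrightarrow> norm (\<phi> z *\<^sub>R D\<omega> (u z)) \<le> C"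
      using bnd[OF c] by (auto simp: bounded_iff)
    have ul: "uniform_limit (space ?M) (\<lambda>n z. \<phi> z *\<^sub>R D\<omega> (U n z)) (\<lambda>z. \<phi> z *\<^sub>R D\<omega> (u z)) sequentially"
      using bounded_bilinear.bounded_uniform_limit[OF bounded_bilinear_scaleR uniform_limit_const compl[OF D\<omega>_cont] bnd[OF cu[OF D\<omega>_cont]] bnd[OF \<phi>K(1)]]
      by simp
    have ap: "(\<lambda>z. (\<phi> z *\<^sub>R D\<omega> (u z)) v) \<in> borel_measurable ?M" for v
      by (rule Mcont, rule blinfun.continuous_on[OF c continuous_on_const])
    have me: "(\<lambda>z. (\<phi> z *\<^sub>R D\<omega> (u z)) (G j z) \<bullet> G i z) \<in> borel_measurable ?M"
      by (rule borel_measurable_inner[OF borel_measurable_blinfun_apply[OF ap Mmeas[OF G_meas]] Mmeas[OF G_meas]])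
    have bd: "norm (\<phi> z *\<^sub>R D\<omega> (u z)) \<le> C" if "z \<in> space ?M" for z
      using C[of z] that by simp
    note lim = L2_blinfun_limit[where M = ?M and f' = "\<lambda>n. U' n j" and f = "G j" and g' = "\<lambda>n. U' n i" and g = "G i"
        and B' = "\<lambda>n z. \<phi> z *\<^sub>R D\<omega> (U n z)" and B = "\<lambda>z. \<phi> z *\<^sub>R D\<omega> (u z)" and C = C,
        OF Mcont[OF Ucont(2)] Mmeas[OF G_meas] Mcont[OF Ucont(2)] Mmeas[OF G_meas]
            GfinM GfinM Glim Glim ul bd me Aint]
    show "integrable ?M (\<lambda>z. (\<phi> z *\<^sub>R D\<omega> (u z)) (G j z) \<bullet> G i z)"
      by (rule lim(1))
    show "(\<lambda>n. A n i j) \<longlonglongrightarrow> A0 i j"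
      unfolding A_def A0_def by (rule lim(2))
  qed
  have B: "(\<lambda>n. B n i j) \<longlonglongrightarrow> 0" for i j
  proof -
    have c: "continuous_on K (\<lambda>z. \<phi>' j z *\<^sub>R blinfun_inner_right (\<omega> (u z)))"
      by (intro continuous_on_scaleR \<phi>K bounded_linear.continuous_on[OF bounded_linear_blinfun_inner_right] cu[OF \<omega>_cont])
    obtain C where C: "\<And>z. z \<in> K \<Longrightarrow> norm (\<phi>' j z *\<^sub>R blinfun_inner_right (\<omega> (u z))) \<le> C"
      using bnd[OF c] by (auto simp: bounded_iff)
    have c2: "continuous_on \<Omega> (\<lambda>y. blinfun_inner_right (\<omega> y))"
      by (rule bounded_linear.continuous_on[OF bounded_linear_blinfun_inner_right \<omega>_cont])
    have ul: "uniform_limit (space ?M) (\<lambda>n z. \<phi>' j z *\<^sub>R blinfun_inner_right (\<omega> (U n z))) (\<lambda>z. \<phi>' j z *\<^sub>R blinfun_inner_right (\<omega> (u z))) sequentially"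
      using bounded_bilinear.bounded_uniform_limit[OF bounded_bilinear_scaleR uniform_limit_const compl[OF c2] bnd[OF cu[OF c2]] bnd[OF \<phi>K(2)]]
      by simp
    have ap: "(\<lambda>z. (\<phi>' j z *\<^sub>R blinfun_inner_right (\<omega> (u z))) v) \<in> borel_measurable ?M" for v
      by (rule Mcont, rule blinfun.continuous_on[OF c continuous_on_const])
    have me: "(\<lambda>z. (\<phi>' j z *\<^sub>R blinfun_inner_right (\<omega> (u z))) (G i z) \<bullet> 1) \<in> borel_measurable ?M"
      by (rule borel_measurable_inner[OF borel_measurable_blinfun_apply[OF ap Mmeas[OF G_meas]] borel_measurable_const])
    have bd: "norm (\<phi>' j z *\<^sub>R blinfun_inner_right (\<omega> (u z))) \<le> C" if "z \<in> space ?M" for z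
      using C[of z] that by simp
    have z: "(\<lambda>n. \<integral>\<^sup>+ x. ennreal ((norm ((1::real) - 1))\<^sup>2) \<partial>?M) \<longlonglongrightarrow> 0"
      by simp
    have lim: "(\<lambda>n. B n i j) \<longlonglongrightarrow> (\<integral>z. (\<phi>' j z *\<^sub>R blinfun_inner_right (\<omega> (u z))) (G i z) \<bullet> 1 \<partial>?M)"
      unfolding B_def
      by (rule L2_blinfun_limit(2)[where M = ?M and f' = "\<lambda>n. U' n i" and f = "G i" and g' = "\<lambda>n z. 1" and g = "\<lambda>z. 1"
        and B' = "\<lambda>n z. \<phi>' j z *\<^sub>R blinfun_inner_right (\<omega> (U n z))" and B = "\<lambda>z. \<phi>' j z *\<^sub>R blinfun_inner_right (\<omega> (u z))" and C = C,
        OF Mcont[OF Ucont(2)] Mmeas[OF G_meas] borel_measurable_const borel_measurable_const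
            GfinM constM Glim z ul bd me Bint])
    have "(\<integral>z. (\<phi>' j z *\<^sub>R blinfun_inner_right (\<omega> (u z))) (G i z) \<bullet> 1 \<partial>?M) = 0"
    proof (rule integral_eq_zero_AE)
      have "AE z in lborel. z \<in> K \<longrightarrow> (\<phi>' j z *\<^sub>R blinfun_inner_right (\<omega> (u z))) (G i z) \<bullet> 1 = 0"
        using orth by eventually_elim (use KD in \<open>auto simp: blinfun.scaleR_left\<close>)
      then show "AE z in ?M. (\<phi>' j z *\<^sub>R blinfun_inner_right (\<omega> (u z))) (G i z) \<bullet> 1 = 0"
        by (simp add: AE_restrict_space_iff)
    qed
    with lim show ?thesis by simp
  qed
  have "A n i j - A n j i + B n i j - B n j i = 0" for n
  proof -
    have "A n i j - A n j i + B n i j - B n j i = (\<integral>z. (\<phi> z *\<^sub>R D\<omega> (U n z)) (U' n j z) \<bullet> U' n i z - (\<phi> z *\<^sub>R D\<omega> (U n z)) (U' n i z) \<bullet> U' n j z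
       + (\<phi>' j z *\<^sub>R blinfun_inner_right (\<omega> (U n z))) (U' n i z) \<bullet> 1 - (\<phi>' i z *\<^sub>R blinfun_inner_right (\<omega> (U n z))) (U' n j z) \<bullet> 1 \<partial>?M)"
      unfolding A_def B_def
      by (simp only: Bochner_Integration.integral_diff Bochner_Integration.integral_add
          Bochner_Integration.integrable_diff Bochner_Integration.integrable_add Aint Bint)
    also have "\<dots> = (\<integral>z. indicator K z * (\<phi> z * (D\<omega> (U n z) (U' n j z) \<bullet> U' n i z) - \<phi> z * (D\<omega> (U n z) (U' n i z) \<bullet> U' n j z)
      + \<phi>' j z * (\<omega> (U n z) \<bullet> U' n i z) - \<phi>' i z * (\<omega> (U n z) \<bullet> U' n j z)) \<partial>lborel)"
      by (simp add: integral_restrict_space blinfun.scaleR_left)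
    also have "\<dots> = 0"
      by (rule smooth_curl_identity[OF U U' U'' \<phi> \<phi>'_cont cK \<phi>_0 \<omega>(1,2)]) (use UN N\<Omega> in auto)
    finally show ?thesis .
  qed
  moreover have "(\<lambda>n. A n i j - A n j i + B n i j - B n j i) \<longlonglongrightarrow> A0 i j - A0 j i + 0 - 0"
    by (rule tendsto_diff[OF tendsto_add[OF tendsto_diff[OF A(2) A(2)] B] B])
  ultimately have A0: "A0 i j - A0 j i = 0"
    by (simp add: LIMSEQ_const_iff)
  have "A0 i j - A0 j i = (\<integral>z. (\<phi> z *\<^sub>R D\<omega> (u z)) (G j z) \<bullet> G i z - (\<phi> z *\<^sub>R D\<omega> (u z)) (G i z) \<bullet> G j z \<partial>?M)"
    unfolding A0_def by (rule Bochner_Integration.integral_diff[OF A(1) A(1), symmetric])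
  also have "\<dots> = (\<integral>z. indicator K z * (\<phi> z * (D\<omega> (u z) (G j z) \<bullet> G i z - D\<omega> (u z) (G i z) \<bullet> G j z)) \<partial>lborel)"
    by (simp add: integral_restrict_space blinfun.scaleR_left right_diff_distrib)
  finally show ?thesis using A0 by simp
qed

end

section \<open>From the integrated curl identity to an identity almost everywhere\<close>

context sobolev_box
begin

text \<open>With the test function \<rho> (x - z), the preceding identity says that the symmetry
  defect \<open>F\<close> has mollification 0 at each x in the ball. Mollifications converge to
  \<open>F\<close> in L^1, so the integral of \<bar>F\<bar> over the ball is below every positive
  number.\<close>

lemma weak_curl_zero:
  assumes r: "r > 0" "cball z0 (2 * r) \<subseteq> cbox a b"
    and \<omega>: "C1_with \<Omega> \<omega> D\<omega>" "open \<Omega>" "u ` cbox a b \<subseteq> \<Omega>"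
    and orth: "AE z in lborel. z \<in> cbox a b \<longrightarrow> (\<forall>i. \<omega> (u z) \<bullet> G i z = 0)"
  shows "AE z in lborel. z \<in> ball z0 r \<longrightarrow> D\<omega> (u z) (G j z) \<bullet> G i z = D\<omega> (u z) (G i z) \<bullet> G j z"
proof -
  let ?D = "cbox a b"
  \<comment> \<open>The cut-off makes the defect a Borel function on the whole space, bounded by a
    multiple of the squared gradients and hence integrable.\<close>
  define T where "T z = indicator ?D z *\<^sub>R D\<omega> (u z)" for z
  define F where "F z = T z (G j z) \<bullet> G i z - T z (G i z) \<bullet> G j z" for z
  have c: "continuous_on ?D (\<lambda>z. D\<omega> (u z))"
    by (rule continuous_on_compose2[OF _ u_cont \<omega>(3)]) (use \<omega>(1) in \<open>simp add: C1_with_def\<close>)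
  have Tm: "(\<lambda>z. T z v) \<in> borel_measurable borel" for v
    unfolding T_def blinfun.scaleR_left
    by (rule borel_measurable_continuous_on_indicator[OF _ blinfun.continuous_on[OF c continuous_on_const]]) simp
  have [measurable]: "(\<lambda>z. T z (G l z)) \<in> borel_measurable borel" for l
    by (rule borel_measurable_blinfun_apply[OF Tm G_meas])
  have Fm[measurable]: "F \<in> borel_measurable borel"
    unfolding F_def[abs_def] by measurable
  obtain C where C: "\<And>z. z \<in> ?D \<Longrightarrow> norm (D\<omega> (u z)) \<le> C"
    using compact_imp_bounded[OF compact_continuous_image[OF c compact_cbox]] by (auto simp: bounded_iff)
  have TC: "norm (T z) \<le> max C 0" for z
    using C[of z] by (auto simp: T_def indicator_def)
  have Tb: "\<bar>T z v \<bullet> w\<bar> \<le> max C 0 * (norm v * norm w)" for z v w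
  proof -
    have "\<bar>T z v \<bullet> w\<bar> \<le> norm (T z v) * norm w"
      by (rule Cauchy_Schwarz_ineq2)
    also have "\<dots> \<le> (max C 0 * norm v) * norm w"
      by (intro mult_right_mono order_trans[OF norm_blinfun] TC) auto
    finally show ?thesis by (simp add: mult.assoc)
  qed
  have Fi: "integrable lborel F"
  proof (rule Bochner_Integration.integrable_bound)
    show "integrable lborel (\<lambda>z. max C 0 * ((norm (G j z))\<^sup>2 + (norm (G i z))\<^sup>2))"
      by (intro integrable_mult_right Bochner_Integration.integrable_add G_square_integrable)
    have "\<bar>F z\<bar> \<le> max C 0 * ((norm (G j z))\<^sup>2 + (norm (G i z))\<^sup>2)" for z
    proof -
      have "\<bar>F z\<bar> \<le> \<bar>T z (G j z) \<bullet> G i z\<bar> + \<bar>T z (G i z) \<bullet> G j z\<bar>"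
        unfolding F_def by (rule abs_triangle_ineq4)
      also have "\<dots> \<le> max C 0 * (norm (G j z) * norm (G i z)) + max C 0 * (norm (G i z) * norm (G j z))"
        by (intro add_mono Tb)
      also have "\<dots> = max C 0 * (2 * norm (G j z) * norm (G i z))"
        by (simp add: algebra_simps)
      also have "\<dots> \<le> max C 0 * ((norm (G j z))\<^sup>2 + (norm (G i z))\<^sup>2)"
        by (intro mult_left_mono sum_squares_bound) simp
      finally show ?thesis .
    qed
    then show "AE z in lborel. norm (F z) \<le> norm (max C 0 * ((norm (G j z))\<^sup>2 + (norm (G i z))\<^sup>2))"
      by (auto intro!: AE_I2 order_trans[OF _ abs_ge_self])
  qed simp
  have conv0: "conv \<rho> F x = 0" if x: "x \<in> ball z0 r" and m: "mollifier \<delta> \<rho> \<rho>' \<rho>''" and \<delta>: "0 < \<delta>" "\<delta> < r" for x \<delta> \<rho> \<rho>' \<rho>''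
  proof -
    let ?K = "cball x \<delta>"
    \<comment> \<open>The radius is split as support plus margin to match
      \<open>weak_curl_identity\<close>; in total it is r, and a ball of radius r about a point of
      the ball of radius r stays within distance 2 r of the centre.\<close>
    have xr: "cball x (\<delta> + (r - \<delta>)) \<subseteq> ?D"
    proof
      fix w assume "w \<in> cball x (\<delta> + (r - \<delta>))"
      then have "w \<in> cball z0 (2 * r)"
        using x dist_triangle[of z0 w x] by simp
      then show "w \<in> ?D" using r(2) by auto
    qed
    have KD: "?K \<subseteq> ?D" using xr \<delta> by (auto simp: subset_iff)
    have \<rho>: "(\<rho> has_derivative (\<lambda>h. \<Sum>i\<in>UNIV. h $ i * \<rho>' i z)) (at z)"
      "(\<rho>' i has_derivative (\<lambda>h. \<Sum>j\<in>UNIV. h $ j * \<rho>'' i j z)) (at z)" for z i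
      using m unfolding mollifier_def by blast+
    have \<rho>'_cont: "continuous_on UNIV (\<rho>' i)" for i
      by (rule has_derivative_continuous_on[OF has_derivative_at_withinI[OF \<rho>(2)]])
    have \<phi>d: "((\<lambda>z. \<rho> (x - z)) has_derivative (\<lambda>h. \<Sum>i\<in>UNIV. h $ i * - \<rho>' i (x - z))) (at z)" for z
    proof -
      have "((\<lambda>y. x - y) has_derivative uminus) (at z)"
        by (auto intro!: derivative_eq_intros)
      from has_derivative_compose[OF this \<rho>(1)] show ?thesis
        by (simp add: sum_negf)
    qed
    have \<phi>c: "continuous_on UNIV (\<lambda>z. - \<rho>' i (x - z))" for i
      by (intro continuous_on_minus continuous_on_compose2[OF \<rho>'_cont] continuous_intros) auto
    have \<phi>0: "\<rho> (x - z) = 0" if "z \<notin> ?K" for z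
      using that kernelD(3)[OF mollifier_kernel[OF m], of "x - z"] by (simp add: dist_norm)
    have "(\<integral>z. indicator ?K z * (\<rho> (x - z) * (D\<omega> (u z) (G j z) \<bullet> G i z - D\<omega> (u z) (G i z) \<bullet> G j z)) \<partial>lborel) = 0"
      by (rule weak_curl_identity[OF refl \<delta>(1) _ xr \<phi>d \<phi>c \<phi>0 \<omega> orth]) (use \<delta> in simp)
    moreover have "indicator ?K z * (\<rho> (x - z) * (D\<omega> (u z) (G j z) \<bullet> G i z - D\<omega> (u z) (G i z) \<bullet> G j z)) = \<rho> (x - z) *\<^sub>R F z" for z
      using KD kernelD(3)[OF mollifier_kernel[OF m], of "x - z"]
      by (cases "z \<in> ?K") (auto simp: F_def T_def dist_norm)
    ultimately show ?thesis
      using conv_alt[OF kernelD(5)[OF mollifier_kernel[OF m]] Fm] by simp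
  qed
  have le: "(\<integral>\<^sup>+ z. ennreal \<bar>F z\<bar> * indicator (ball z0 r) z \<partial>lborel) \<le> 0 + ennreal e" if e: "e > 0" for e
  proof -
    obtain d where d: "d > 0" "\<And>y. norm y < d \<Longrightarrow> shift_dist F y \<le> ennreal e"
      using shift_dist_small[OF Fi e] by metis
    define \<delta> where "\<delta> = min d r / 2"
    have \<delta>: "0 < \<delta>" "\<delta> < r" "\<delta> < d" using d r by (auto simp: \<delta>_def)
    obtain \<rho> :: "real^'k \<Rightarrow> real" and \<rho>' \<rho>'' where m: "mollifier \<delta> \<rho> \<rho>' \<rho>''"
      using mollifier_exists[OF \<delta>(1)] by metis
    have "(\<integral>\<^sup>+ z. ennreal \<bar>F z\<bar> * indicator (ball z0 r) z \<partial>lborel) \<le> (\<integral>\<^sup>+ z. norm (conv \<rho> F z - F z) \<partial>lborel)"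
      using conv0[OF _ m \<delta>(1,2)] by (intro nn_integral_mono) (auto simp: indicator_def)
    also have "\<dots> \<le> ennreal e"
      by (rule conv_L1_error[OF mollifier_kernel[OF m] Fi d(2)]) (use \<delta> in simp)
    finally show ?thesis by simp
  qed
  have "(\<integral>\<^sup>+ z. ennreal \<bar>F z\<bar> * indicator (ball z0 r) z \<partial>lborel) \<le> 0"
    by (rule ennreal_le_epsilon) (use le in simp)
  moreover have "(\<lambda>z. ennreal \<bar>F z\<bar> * indicator (ball z0 r) z) \<in> borel_measurable lborel"
    by (intro borel_measurable_times_ennreal borel_measurable_indicator) (use Fm in auto)
  ultimately have "AE z in lborel. ennreal \<bar>F z\<bar> * indicator (ball z0 r) z = 0"
    by (simp add: nn_integral_0_iff_AE)
  then show ?thesis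
  proof eventually_elim
    case (elim z)
    show ?case
    proof
      assume z: "z \<in> ball z0 r"
      have "z \<in> cball z0 (2 * r)" using z r(1) by simp
      then have "z \<in> ?D" using r(2) by auto
      then show "D\<omega> (u z) (G j z) \<bullet> G i z = D\<omega> (u z) (G i z) \<bullet> G j z"
        using elim z by (simp add: F_def T_def)
    qed
  qed
qed

end

section \<open>Borel representatives and almost everywhere vanishing\<close>

lemma completion_ex_borel_measurable_euclidean:
  fixes f :: "'a \<Rightarrow> 'b::euclidean_space"
  assumes [measurable]: "f \<in> borel_measurable (completion M)"
  obtains g where "g \<in> borel_measurable M" "AE x in M. f x = g x"
proof -
  have "\<forall>b. \<exists>g'\<in>borel_measurable M. AE x in M. f x \<bullet> b = g' x"
    by (intro allI completion_ex_borel_measurable_real) measurable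
  then obtain g where g: "\<And>b. g b \<in> borel_measurable M" "\<And>b. AE x in M. f x \<bullet> b = g b x"
    by metis
  note [measurable] = g(1)
  have "AE x in M. \<forall>b\<in>Basis. f x \<bullet> b = g b x"
    using g(2) by (intro AE_ball_countable[THEN iffD2]) (auto intro: countable_finite)
  then have "AE x in M. f x = (\<Sum>b\<in>Basis. g b x *\<^sub>R b)"
    by eventually_elim (simp add: euclidean_eq_iff[where 'a = 'b] inner_sum_left_Basis)
  then show thesis
    by (intro that[of "\<lambda>x. \<Sum>b\<in>Basis. g b x *\<^sub>R b"]) measurable
qed

lemma continuous_AE_zero:
  fixes f :: "'a::euclidean_space \<Rightarrow> real"
  assumes S: "open S" and f: "continuous_on S f" and ae: "AE x in lborel. x \<in> S \<longrightarrow> f x = 0" and "x \<in> S"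
  shows "f x = 0"
proof (rule ccontr)
  let ?N = "S \<inter> f -` (- {0})"
  assume "f x \<noteq> 0"
  then have ne: "?N \<noteq> {}" using \<open>x \<in> S\<close> by auto
  have op: "open ?N"
    by (rule continuous_open_preimage[OF f S]) auto
  have "emeasure lborel ?N = 0"
    using AE_iff_measurable[of ?N lborel "\<lambda>x. x \<in> S \<longrightarrow> f x = 0"] op ae by (auto simp: borel_open)
  then have "negligible ?N"
    using op by (simp add: negligible_iff_null_sets null_sets_def)
  then show False
    using open_not_negligible[OF op ne] by simp
qed

section \<open>Involutivity\<close>

lemma mollifier_test_function:
  assumes m: "mollifier \<delta> \<rho> \<rho>' \<rho>''" and "cball x \<delta> \<subseteq> A"
  shows "test_function A (\<lambda>y. \<rho> (x - y))"
proof -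
  have "{z. \<rho> (x - z) \<noteq> 0} \<subseteq> cball x \<delta>"
  proof
    fix z assume "z \<in> {z. \<rho> (x - z) \<noteq> 0}"
    then have "\<not> norm (x - z) \<ge> \<delta>"
      using kernelD(3)[OF mollifier_kernel[OF m]] by auto
    then show "z \<in> cball x \<delta>" by (simp add: dist_norm)
  qed
  then have c: "closure {z. \<rho> (x - z) \<noteq> 0} \<subseteq> cball x \<delta>"
    by (simp add: closure_minimal)
  then have "compact (closure {z. \<rho> (x - z) \<noteq> 0})"
    by (meson bounded_cball bounded_subset closed_closure compact_eq_bounded_closed)
  moreover have "Cm_fun n (\<lambda>y. \<rho> (x - y))" for n
    using Cm_fun_reflect[of n \<rho> 1 x] m by (simp add: mollifier_def)
  ultimately show ?thesis
    using c assms(2) by (auto simp: test_function_def)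
qed

text \<open>The inequality is strict because \<rho> vanishes on the open complement of the closed
  ball, and only there is its derivative read off from the constant 0.\<close>

lemma mollifier_deriv_supp:
  assumes m: "mollifier \<delta> \<rho> \<rho>' \<rho>''" and z: "norm z > \<delta>"
  shows "\<rho>' i z = 0"
proof -
  have "(\<rho> has_derivative (\<lambda>_. 0)) (at z)"
  proof (rule has_derivative_transform_within_open[of "\<lambda>_. 0" _ _ _ "- cball 0 \<delta>"])
    show "\<And>w. w \<in> - cball 0 \<delta> \<Longrightarrow> 0 = \<rho> w"
      using m by (auto simp: mollifier_def)
  qed (use z in auto)
  moreover have "(\<rho> has_derivative (\<lambda>h. \<Sum>i\<in>UNIV. h $ i * \<rho>' i z)) (at z)"
    using m by (simp add: mollifier_def)
  ultimately have "(\<lambda>h. \<Sum>i\<in>UNIV. h $ i * \<rho>' i z) = (\<lambda>_. 0)"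
    by (rule has_derivative_unique[symmetric])
  from fun_cong[OF this, of "axis i 1"] show ?thesis by simp
qed

text \<open>Translates the hypotheses, phrased with Lebesgue measurability and arbitrary test
  functions on A, into the \<open>sobolev_box\<close> form: Borel gradients that vanish off a
  compact box, and the weak derivative relation for mollifiers alone.\<close>

lemma sobolev_box_exists:
  fixes u :: "real^'k \<Rightarrow> 'b::euclidean_space"
  assumes A: "open A" and u: "continuous_on A u" and W: "W1p_loc_with p A u Du" and p: "p \<ge> 2"
    and D: "cbox a b \<subseteq> A"
  obtains G where "sobolev_box a b u G" "AE z in lborel. z \<in> cbox a b \<longrightarrow> (\<forall>i. G i z = Du i z)"
proof -
  let ?D = "cbox a b"
  have Du_meas: "(\<lambda>z. indicator A z *\<^sub>R Du i z) \<in> borel_measurable lebesgue" for i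
    using W by (simp add: W1p_loc_with_def Lp_loc_def set_borel_measurable_def)
  have "\<exists>g. g \<in> borel_measurable lborel \<and> (AE z in lborel. indicator A z *\<^sub>R Du i z = g z)" for i
    using completion_ex_borel_measurable_euclidean[OF Du_meas[of i]] by metis
  then obtain g where g: "\<And>i. g i \<in> borel_measurable lborel" "\<And>i. AE z in lborel. indicator A z *\<^sub>R Du i z = g i z"
    by metis
  define G where "G i z = indicator ?D z *\<^sub>R g i z" for i z
  have Gm[measurable]: "G i \<in> borel_measurable borel" for i
    unfolding G_def[abs_def] using g(1)[of i] by measurable
  have eq: "AE z in lborel. G i z = indicator ?D z *\<^sub>R Du i z" for i
    using g(2)[of i] by eventually_elim (use D in \<open>auto simp: G_def indicator_def split: if_splits\<close>)
  have eqL: "AE z in lebesgue. G i z = indicator ?D z *\<^sub>R Du i z" for i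
    using eq[of i] by (simp add: AE_completion)
  have L2: "(\<integral>\<^sup>+ z. ennreal ((norm (G i z))\<^sup>2) \<partial>lborel) < \<infinity>" for i
  proof -
    have "set_integrable lebesgue ?D (\<lambda>z. norm (Du i z) powr p)"
      using W D by (simp add: W1p_loc_with_def Lp_loc_def)
    then have "(\<integral>\<^sup>+ z. ennreal (norm (indicator ?D z *\<^sub>R (norm (Du i z) powr p))) \<partial>lebesgue) < \<infinity>"
      unfolding set_integrable_def by (simp add: integrable_iff_bounded)
    moreover have "emeasure lebesgue ?D < \<infinity>"
      using emeasure_bounded_finite[OF bounded_cbox[of a b]] by simp
    ultimately have fin: "(\<integral>\<^sup>+ z. indicator ?D z \<partial>lebesgue) + (\<integral>\<^sup>+ z. ennreal (norm (indicator ?D z *\<^sub>R (norm (Du i z) powr p))) \<partial>lebesgue) < \<infinity>"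
      by simp
    have pm: "(\<lambda>z. ennreal (norm (indicator ?D z *\<^sub>R (norm (Du i z) powr p)))) \<in> borel_measurable lebesgue"
      using \<open>set_integrable lebesgue ?D (\<lambda>z. norm (Du i z) powr p)\<close> unfolding set_integrable_def by measurable
    have "(\<integral>\<^sup>+ z. ennreal ((norm (G i z))\<^sup>2) \<partial>lborel) = (\<integral>\<^sup>+ z. ennreal ((norm (G i z))\<^sup>2) \<partial>lebesgue)"
      by (simp add: nn_integral_completion)
    also have "\<dots> \<le> (\<integral>\<^sup>+ z. indicator ?D z + ennreal (norm (indicator ?D z *\<^sub>R (norm (Du i z) powr p))) \<partial>lebesgue)"
    proof (rule nn_integral_mono_AE)
      \<comment> \<open>Below 1 the square is at most 1, above 1 it is at most the p-th power since
        p >= 2. The constant is integrable because the box has finite measure.\<close>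
      have le: "t\<^sup>2 \<le> 1 + t powr p" if "t \<ge> 0" for t :: real
      proof (cases "t \<ge> 1")
        case True
        then have "t\<^sup>2 = t powr 2" by (simp add: powr_numeral)
        also have "\<dots> \<le> t powr p" using True p by (intro powr_mono) auto
        finally show ?thesis by simp
      next
        case False
        then have "t\<^sup>2 \<le> 1" using that by (simp add: power_le_one)
        then show ?thesis by (simp add: add_increasing2)
      qed
      show "AE z in lebesgue. ennreal ((norm (G i z))\<^sup>2) \<le> indicator ?D z + ennreal (norm (indicator ?D z *\<^sub>R (norm (Du i z) powr p)))"
        using eqL[of i]
      proof eventually_elim
        case (elim z)
        show ?case
        proof (cases "z \<in> ?D")
          case True
          then show ?thesis
            using elim ennreal_leI[OF le[OF norm_ge_zero[of "Du i z"]]] by simp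
        qed (simp add: elim)
      qed
    qed
    also have "\<dots> = (\<integral>\<^sup>+ z. indicator ?D z \<partial>lebesgue) + (\<integral>\<^sup>+ z. ennreal (norm (indicator ?D z *\<^sub>R (norm (Du i z) powr p))) \<partial>lebesgue)"
      by (rule nn_integral_add[OF borel_measurable_indicator pm]) simp
    finally show ?thesis using fin by (rule le_less_trans)
  qed
  have weak: "integral ?D (\<lambda>y. \<rho>' i (x - y) *\<^sub>R u y) = conv \<rho> (G i) x"
    if m: "mollifier \<delta> \<rho> \<rho>' \<rho>''" and x: "cball x \<delta> \<subseteq> ?D" for \<delta> \<rho> \<rho>' \<rho>'' x i
  proof -
    let ?\<phi> = "\<lambda>y. \<rho> (x - y)"
    have \<rho>: "(\<rho> has_derivative (\<lambda>h. \<Sum>i\<in>UNIV. h $ i * \<rho>' i z)) (at z)"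
      "(\<rho>' i has_derivative (\<lambda>h. \<Sum>j\<in>UNIV. h $ j * \<rho>'' i j z)) (at z)" for z i
      using m unfolding mollifier_def by blast+
    have \<rho>'_cont: "continuous_on UNIV (\<rho>' i)" for i
      by (rule has_derivative_continuous_on[OF has_derivative_at_withinI[OF \<rho>(2)]])
    \<comment> \<open>The translated mollifier lives inside the box, so integrals over A and over
      the box agree, and the cut-off in \<open>G\<close> does not change them.\<close>
    have \<rho>0: "\<rho> (x - z) = 0" if "z \<notin> ?D" for z
    proof -
      have "z \<notin> cball x \<delta>" using that x by auto
      then show ?thesis using m by (simp add: mollifier_def dist_norm)
    qed
    have \<rho>'0: "\<rho>' i (x - z) = 0" if "z \<notin> ?D" for z
    proof -
      have "z \<notin> cball x \<delta>" using that x by auto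
      then show ?thesis using mollifier_deriv_supp[OF m] by (simp add: dist_norm)
    qed
    have \<rho>_meas: "?\<phi> \<in> borel_measurable borel"
      using kernelD(5)[OF mollifier_kernel[OF m]] by measurable
    \<comment> \<open>Reflection gives a minus sign, which cancels the one in
      \<open>weak_partial\<close>; the \<open>weak\<close> clause is therefore free of
      signs.\<close>
    have fd: "frechet_derivative ?\<phi> (at z) (axis i 1) = - \<rho>' i (x - z)" for z
    proof -
      have "((\<lambda>y. x - y) has_derivative uminus) (at z)"
        by (auto intro!: derivative_eq_intros)
      from has_derivative_compose[OF this \<rho>(1)]
      have "(?\<phi> has_derivative (\<lambda>h. \<Sum>i\<in>UNIV. - h $ i * \<rho>' i (x - z))) (at z)"
        by simp
      from frechet_derivative_at[OF this, symmetric] show ?thesis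
        by (simp add: sum_negf)
    qed
    have cu: "continuous_on ?D (\<lambda>z. \<rho>' i (x - z) *\<^sub>R u z)"
      by (intro continuous_on_scaleR continuous_on_subset[OF u D] continuous_on_compose2[OF \<rho>'_cont] continuous_intros) auto
    have "weak_partial A i u (Du i)"
      using W by (simp add: W1p_loc_with_def)
    then have "set_lebesgue_integral lebesgue A (\<lambda>z. - \<rho>' i (x - z) *\<^sub>R u z) = - set_lebesgue_integral lebesgue A (\<lambda>z. \<rho> (x - z) *\<^sub>R Du i z)"
      using mollifier_test_function[OF m order_trans[OF x D]] unfolding weak_partial_def by (simp only: fd[symmetric])
    moreover have "set_lebesgue_integral lebesgue A (\<lambda>z. - \<rho>' i (x - z) *\<^sub>R u z) = - integral ?D (\<lambda>y. \<rho>' i (x - y) *\<^sub>R u y)"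
    proof -
      have bm: "(\<lambda>z. indicator ?D z *\<^sub>R (\<rho>' i (x - z) *\<^sub>R u z)) \<in> borel_measurable borel"
        by (rule borel_measurable_continuous_on_indicator[OF _ cu]) simp
      have "(\<lambda>z. indicator A z *\<^sub>R (- \<rho>' i (x - z) *\<^sub>R u z)) = (\<lambda>z. - (indicator ?D z *\<^sub>R (\<rho>' i (x - z) *\<^sub>R u z)))"
        using \<rho>'0 D by (auto simp: indicator_def fun_eq_iff)
      then have "set_lebesgue_integral lebesgue A (\<lambda>z. - \<rho>' i (x - z) *\<^sub>R u z) = - (\<integral>z. indicator ?D z *\<^sub>R (\<rho>' i (x - z) *\<^sub>R u z) \<partial>lebesgue)"
        unfolding set_lebesgue_integral_def by (simp only: Bochner_Integration.integral_minus)
      also have "(\<integral>z. indicator ?D z *\<^sub>R (\<rho>' i (x - z) *\<^sub>R u z) \<partial>lebesgue) = (\<integral>z. indicator ?D z *\<^sub>R (\<rho>' i (x - z) *\<^sub>R u z) \<partial>lborel)"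
        using bm by (intro integral_completion) simp
      finally show ?thesis
        by (simp only: integral_cbox_eq_lborel[OF cu])
    qed
    moreover have "set_lebesgue_integral lebesgue A (\<lambda>z. \<rho> (x - z) *\<^sub>R Du i z) = conv \<rho> (G i) x"
    proof -
      have bm: "(\<lambda>z. \<rho> (x - z) *\<^sub>R G i z) \<in> borel_measurable borel"
        using \<rho>_meas by measurable
      have "set_lebesgue_integral lebesgue A (\<lambda>z. \<rho> (x - z) *\<^sub>R Du i z) = (\<integral>z. \<rho> (x - z) *\<^sub>R G i z \<partial>lebesgue)"
        unfolding set_lebesgue_integral_def
      proof (rule integral_cong_AE)
        have "(\<lambda>z. \<rho> (x - z) *\<^sub>R (indicator A z *\<^sub>R Du i z)) \<in> borel_measurable lebesgue"
          by (rule borel_measurable_scaleR[OF measurable_completion Du_meas]) (use \<rho>_meas in simp)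
        then show "(\<lambda>z. indicator A z *\<^sub>R (\<rho> (x - z) *\<^sub>R Du i z)) \<in> borel_measurable lebesgue"
          by (simp add: mult.commute)
        show "(\<lambda>z. \<rho> (x - z) *\<^sub>R G i z) \<in> borel_measurable lebesgue"
          using bm by (intro measurable_completion) simp
        show "AE z in lebesgue. indicator A z *\<^sub>R (\<rho> (x - z) *\<^sub>R Du i z) = \<rho> (x - z) *\<^sub>R G i z"
          using eqL[of i] by eventually_elim (use \<rho>0 D in \<open>auto simp: indicator_def\<close>)
      qed
      also have "\<dots> = (\<integral>z. \<rho> (x - z) *\<^sub>R G i z \<partial>lborel)"
        using bm by (intro integral_completion) simp
      also have "\<dots> = conv \<rho> (G i) x"
        by (rule conv_alt[OF kernelD(5)[OF mollifier_kernel[OF m]] Gm, symmetric])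
      finally show ?thesis .
    qed
    ultimately show ?thesis by simp
  qed
  have "sobolev_box a b u G"
    by unfold_locales (use continuous_on_subset[OF u D] L2 weak in \<open>auto simp: G_def\<close>)
  moreover have "AE z in lborel. z \<in> ?D \<longrightarrow> (\<forall>i. G i z = Du i z)"
  proof -
    have "AE z in lborel. \<forall>i\<in>UNIV. G i z = indicator ?D z *\<^sub>R Du i z"
      using eq by (intro AE_ball_countable[THEN iffD2]) (auto intro: countable_finite)
    then show ?thesis
      by eventually_elim simp
  qed
  ultimately show thesis by (rule that)
qed

section \<open>A criterion for involutivity, and the conclusion\<close>

lemma bounded_linear_matrix_vector_left: "bounded_linear (\<lambda>M::real^'m^'n. M *v x)"
  by (rule linear_conv_bounded_linear[THEN iffD1], rule linearI)
    (auto simp: matrix_vector_mult_add_rdistrib scaleR_matrix_vector_assoc)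

text \<open>For a tangent field v the function \<omega> \<bullet> v is identically 0, and its
  derivative at x expresses \<omega>(x) \<bullet> Dv h by the derivative of the projection. Thus
  \<omega>(x) tested against the bracket is exactly the antisymmetric part that \<open>sym\<close>
  makes vanish.\<close>

lemma involutive_atI:
  fixes V :: "real^'n \<Rightarrow> (real^'n) set"
  assumes \<Omega>: "open \<Omega>" "x \<in> \<Omega>" and P: "C1_with \<Omega> P DP" "\<And>y. y \<in> \<Omega> \<Longrightarrow> is_orth_proj (P y) (V y)"
    and sym: "\<And>w Dw w' Dw' \<xi>. tangent_C1_field \<Omega> V w Dw \<Longrightarrow> tangent_C1_field \<Omega> V w' Dw' \<Longrightarrow>
      (DP x (w x) *v \<xi>) \<bullet> w' x = (DP x (w' x) *v \<xi>) \<bullet> w x"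
  shows "involutive_at \<Omega> V x"
  unfolding involutive_at_def
proof (intro allI impI, elim conjE)
  fix w Dw w' Dw' assume w: "tangent_C1_field \<Omega> V w Dw" and w': "tangent_C1_field \<Omega> V w' Dw'"
  \<comment> \<open>Choosing \<xi> as the bracket itself makes \<omega>(x) its component normal to
    V(x). This component is orthogonal to \<xi> by symmetry and to P \<xi> by projection, hence to
    itself.\<close>
  define \<xi> where "\<xi> = Dw x (w' x) - Dw' x (w x)"
  define \<omega> where "\<omega> y = \<xi> - P y *v \<xi>" for y
  have \<omega>_deriv: "(\<omega> has_derivative (\<lambda>h. - (DP x h *v \<xi>))) (at x)"
  proof -
    from bounded_linear.has_derivative[OF bounded_linear_matrix_vector_left, of P "blinfun_apply (DP x)" "at x" \<xi>] P(1) \<Omega>(2)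
    show ?thesis
      unfolding \<omega>_def[abs_def] C1_with_def by (auto intro!: derivative_eq_intros)
  qed
  have *: "\<omega> x \<bullet> Dv x h = (DP x h *v \<xi>) \<bullet> v x" if v: "tangent_C1_field \<Omega> V v Dv" for v Dv h
  proof -
    have "((\<lambda>y. \<omega> y \<bullet> v y) has_derivative (\<lambda>h. \<omega> x \<bullet> Dv x h + - (DP x h *v \<xi>) \<bullet> v x)) (at x)"
      using v \<Omega>(2) by (intro has_derivative_inner \<omega>_deriv) (simp add: tangent_C1_field_def C1_with_def)
    moreover have "((\<lambda>y. \<omega> y \<bullet> v y) has_derivative (\<lambda>_. 0)) (at x)"
      by (rule has_derivative_transform_within_open[OF has_derivative_const \<Omega>])
        (use v P(2) in \<open>auto simp: tangent_C1_field_def is_orth_proj_def \<omega>_def\<close>)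
    ultimately have "(\<lambda>h. \<omega> x \<bullet> Dv x h + - (DP x h *v \<xi>) \<bullet> v x) = (\<lambda>_. 0)"
      by (rule has_derivative_unique)
    from fun_cong[OF this, of h] show ?thesis by simp
  qed
  have "\<omega> x \<bullet> \<xi> = 0"
    using *[OF w, of "w' x"] *[OF w', of "w x"] sym[OF w w', of \<xi>]
    by (simp add: \<xi>_def inner_diff_right)
  moreover have "P x *v \<xi> \<in> V x" "\<omega> x \<bullet> (P x *v \<xi>) = 0"
    using P(2)[OF \<Omega>(2)] by (auto simp: is_orth_proj_def \<omega>_def)
  ultimately have "\<omega> x \<bullet> \<omega> x = 0"
    by (simp add: \<omega>_def inner_diff_right)
  then have "\<xi> = P x *v \<xi>"
    by (simp add: \<omega>_def)
  then show "Dw x (w' x) - Dw' x (w x) \<in> V x"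
    using \<open>P x *v \<xi> \<in> V x\<close> by (simp add: \<xi>_def[symmetric])
qed

text \<open>Carries the symmetry from the partial derivatives to arbitrary vectors of their span,
  among them the values of tangent fields along \<open>u\<close>.\<close>

lemma bilinear_symmetric_on_range:
  fixes T :: "'b::real_inner \<Rightarrow>\<^sub>L 'b"
  assumes "\<And>i j. T (D j z) \<bullet> D i z = T (D i z) \<bullet> D j z" and "v \<in> diff_image D z" "w \<in> diff_image D z"
  shows "T v \<bullet> w = T w \<bullet> v"
proof -
  obtain c d where c: "v = (\<Sum>i\<in>UNIV. c $ i *\<^sub>R D i z)" and d: "w = (\<Sum>i\<in>UNIV. d $ i *\<^sub>R D i z)"
    using assms(2,3) unfolding diff_image_def by auto
  have "T v \<bullet> w = (\<Sum>i\<in>UNIV. \<Sum>n\<in>UNIV. d $ i * (c $ n * (T (D n z) \<bullet> D i z)))"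
    unfolding c d by (simp add: blinfun.sum_right blinfun.scaleR_right inner_sum_left inner_sum_right sum_distrib_left)
  also have "\<dots> = (\<Sum>i\<in>UNIV. \<Sum>n\<in>UNIV. d $ n * (c $ i * (T (D i z) \<bullet> D n z)))"
    by (rule sum.swap)
  also have "\<dots> = (\<Sum>i\<in>UNIV. \<Sum>n\<in>UNIV. c $ i * (d $ n * (T (D n z) \<bullet> D i z)))"
    by (intro sum.cong refl) (metis assms(1) mult.left_commute)
  also have "\<dots> = T w \<bullet> v"
    unfolding c d by (simp add: blinfun.sum_right blinfun.scaleR_right inner_sum_left inner_sum_right sum_distrib_left)
  finally show ?thesis .
qed

theorem theorem1p12:
  fixes \<Omega> :: "(real^'n) set" and V :: "real^'n \<Rightarrow> (real^'n) set"
    and A :: "(real^'k) set" and u :: "real^'k \<Rightarrow> real^'n" and p :: real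
  assumes "open \<Omega>"
    and "C1_distribution \<Omega> CARD('k) V"
    and "open A"
    and "continuous_on A u" and "u ` A \<subseteq> \<Omega>"
    and "p > real CARD('k)"
    and "\<exists>Du. W1p_loc_with p A u Du \<and>
           (AE z in lebesgue. z \<in> A \<longrightarrow> diff_image Du z = V (u z))"
  shows "u ` A \<inter> non_involutive_set \<Omega> V = {}"
proof -
  obtain P DP where P: "C1_with \<Omega> P DP" "\<And>y. y \<in> \<Omega> \<Longrightarrow> is_orth_proj (P y) (V y)"
    using assms(2) by (auto simp: C1_distribution_def C1_on_def)
  obtain Du where W: "W1p_loc_with p A u Du" and "AE z in lebesgue. z \<in> A \<longrightarrow> diff_image Du z = V (u z)"
    using assms(7) by auto
  then have V: "AE z in lborel. z \<in> A \<longrightarrow> diff_image Du z = V (u z)"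
    by (simp add: AE_completion_iff)
  have Du_image: "Du i z \<in> diff_image Du z" for i z
    unfolding diff_image_def by (rule range_eqI[of _ _ "axis i 1"]) simp
  have "involutive_at \<Omega> V (u z0)" if z0: "z0 \<in> A" for z0
  proof (rule involutive_atI[OF assms(1) _ P])
    show "u z0 \<in> \<Omega>" using z0 assms(5) by auto
    fix w Dw w' Dw' \<xi> assume w: "tangent_C1_field \<Omega> V w Dw" and w': "tangent_C1_field \<Omega> V w' Dw'"
    define \<omega> where "\<omega> y = \<xi> - P y *v \<xi>" for y
    \<comment> \<open>As a bounded linear map this makes \<open>D\<omega>\<close> a composition with
      \<open>DP\<close>, so its continuity is inherited.\<close>
    define E where "E = Blinfun (\<lambda>M::real^'n^'n. - (M *v \<xi>))"
    have bl: "bounded_linear (\<lambda>M::real^'n^'n. - (M *v \<xi>))"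
      by (rule bounded_linear_minus[OF bounded_linear_matrix_vector_left])
    then have E: "blinfun_apply E M = - (M *v \<xi>)" for M
      by (simp add: E_def bounded_linear_Blinfun_apply)
    define D\<omega> where "D\<omega> y = E o\<^sub>L DP y" for y
    have D\<omega>: "D\<omega> y h = - (DP y h *v \<xi>)" for y h
      by (simp add: D\<omega>_def E)
    have \<omega>: "C1_with \<Omega> \<omega> D\<omega>"
      unfolding C1_with_def
    proof (intro conjI ballI)
      fix y assume "y \<in> \<Omega>"
      then have "(P has_derivative blinfun_apply (DP y)) (at y)"
        using P(1) by (simp add: C1_with_def)
      from has_derivative_add[OF has_derivative_const[of \<xi>] bounded_linear.has_derivative[OF bl this]]
      show "(\<omega> has_derivative blinfun_apply (D\<omega> y)) (at y)"
        by (simp add: \<omega>_def[abs_def] D\<omega>[abs_def])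
    next
      show "continuous_on \<Omega> D\<omega>"
        unfolding D\<omega>_def[abs_def]
        by (rule bounded_bilinear.continuous_on[OF bounded_bilinear_blinfun_compose continuous_on_const])
          (use P(1) in \<open>simp add: C1_with_def\<close>)
    qed
    have \<omega>V: "\<omega> y \<bullet> v = 0" if "y \<in> \<Omega>" "v \<in> V y" for y v
      using P(2)[OF that(1)] that(2) by (simp add: is_orth_proj_def \<omega>_def)
    obtain a b where ab: "cbox a b \<subseteq> A" "z0 \<in> box a b"
      by (rule open_contains_cbox[OF assms(3) z0])
    from open_contains_cball[THEN iffD1, OF open_box, rule_format, OF ab(2)]
    obtain r' where r': "r' > 0" "cball z0 r' \<subseteq> box a b"
      by (elim exE conjE)
    \<comment> \<open>Halving leaves room for the doubled radius in
      \<open>weak_curl_zero\<close>.\<close>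
    define r where "r = r' / 2"
    have r: "r > 0" "cball z0 (2 * r) \<subseteq> cbox a b"
      using r'(1) order_trans[OF r'(2) box_subset_cbox] by (simp_all add: r_def)
    have rD: "ball z0 r \<subseteq> cbox a b"
      by (rule order_trans[OF _ r(2)]) (use r(1) in auto)
    note rA = order_trans[OF rD ab(1)]
    have sym: "AE z in lborel. z \<in> ball z0 r \<longrightarrow> D\<omega> (u z) (Du j z) \<bullet> Du i z = D\<omega> (u z) (Du i z) \<bullet> Du j z" for i j
    proof (cases "i = j")
      case False
      \<comment> \<open>Two distinct indices force the dimension to be at least 2, which is where
        the bound p >= 2 comes from.\<close>
      then have "card {i, j} \<le> CARD('k)"
        by (intro card_mono) auto
      then have "p \<ge> 2" using assms(6) False by simp
      then obtain G where G: "sobolev_box a b u G" "AE z in lborel. z \<in> cbox a b \<longrightarrow> (\<forall>i. G i z = Du i z)"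
        by (rule sobolev_box_exists[OF assms(3,4) W _ ab(1)])
      have orth: "AE z in lborel. z \<in> cbox a b \<longrightarrow> (\<forall>i. \<omega> (u z) \<bullet> G i z = 0)"
        using G(2) V
      proof eventually_elim
        case (elim z)
        show ?case
        proof (intro impI allI)
          fix i assume z: "z \<in> cbox a b"
          then have zA: "z \<in> A" using ab(1) by auto
          then have "Du i z \<in> V (u z)" "u z \<in> \<Omega>"
            using elim(2) Du_image[of i z] assms(5) by auto
          then show "\<omega> (u z) \<bullet> G i z = 0"
            using \<omega>V elim(1) z by simp
        qed
      qed
      have "u ` cbox a b \<subseteq> \<Omega>" using ab(1) assms(5) by blast
      then have "AE z in lborel. z \<in> ball z0 r \<longrightarrow> D\<omega> (u z) (G j z) \<bullet> G i z = D\<omega> (u z) (G i z) \<bullet> G j z"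
        by (rule sobolev_box.weak_curl_zero[OF G(1) r \<omega> assms(1) _ orth])
      then show ?thesis
        using G(2)
      proof eventually_elim
        case (elim z)
        then show ?case using rD by force
      qed
    qed simp
    \<comment> \<open>The fields stand in for the partial derivatives, which exist only almost
      everywhere. This defect is defined and continuous on the whole ball, so its value at the
      centre \<open>z0\<close> is determined by its values almost everywhere.\<close>
    define s where "s z = D\<omega> (u z) (w (u z)) \<bullet> w' (u z) - D\<omega> (u z) (w' (u z)) \<bullet> w (u z)" for z
    have c: "continuous_on \<Omega> v" if "tangent_C1_field \<Omega> V v Dv" for v Dv
    proof -
      have "(v has_derivative blinfun_apply (Dv y)) (at y)" if "y \<in> \<Omega>" for y
        using \<open>tangent_C1_field \<Omega> V v Dv\<close> that by (simp add: tangent_C1_field_def C1_with_def)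
      then show ?thesis
        by (rule has_derivative_continuous_on[OF has_derivative_at_withinI])
    qed
    have D\<omega>c: "continuous_on \<Omega> D\<omega>"
      using \<omega> by (simp add: C1_with_def)
    have cs: "continuous_on \<Omega> (\<lambda>y. D\<omega> y (w y) \<bullet> w' y - D\<omega> y (w' y) \<bullet> w y)"
      by (intro continuous_on_diff continuous_on_inner blinfun.continuous_on c[OF w] c[OF w'] D\<omega>c)
    have "continuous_on (ball z0 r) s"
      unfolding s_def[abs_def]
      by (rule continuous_on_compose2[OF cs continuous_on_subset[OF assms(4) rA]]) (use rA assms(5) in auto)
    moreover have "AE z in lborel. z \<in> ball z0 r \<longrightarrow> s z = 0"
    proof -
      have "AE z in lborel. \<forall>i\<in>UNIV. \<forall>j\<in>UNIV. z \<in> ball z0 r \<longrightarrow> D\<omega> (u z) (Du j z) \<bullet> Du i z = D\<omega> (u z) (Du i z) \<bullet> Du j z"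
        by (intro AE_ball_countable[THEN iffD2] ballI countable_finite finite sym)
      then show ?thesis
        using V
      proof eventually_elim
        case (elim z)
        show ?case
        proof
          assume z: "z \<in> ball z0 r"
          then have "z \<in> A" using rA by blast
          moreover from this have "u z \<in> \<Omega>" using assms(5) by blast
          ultimately have "w (u z) \<in> diff_image Du z" "w' (u z) \<in> diff_image Du z"
            using elim(2) w w' by (auto simp: tangent_C1_field_def)
          then show "s z = 0"
            using bilinear_symmetric_on_range[of "D\<omega> (u z)" Du z] elim(1) z by (simp add: s_def)
        qed
      qed
    qed
    ultimately have "s z0 = 0"
      using continuous_AE_zero[OF open_ball, of z0 r s z0] r by simp
    then show "(DP (u z0) (w (u z0)) *v \<xi>) \<bullet> w' (u z0) = (DP (u z0) (w' (u z0)) *v \<xi>) \<bullet> w (u z0)"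
      by (simp add: s_def D\<omega>)
  qed
  then show ?thesis
    by (auto simp: non_involutive_set_def)
qed

end
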